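(* Let $N\geq2$. There are constants $c_1>0$ and $c_2>0$, which only depend on the dimension $N$, such that, for any domain $\Omega\subset\mathbb{R}^N$ with $\partial\Omega\neq\emptyset$ and any $u\in W^{1,N}_0(\Omega)$ with $M_N(u)=1$, \[ \int_\Omega\frac{\Phi_N(u/c_1)}{\delta^N}\leq c_2. \]
   Context: A domain is a connected open set. $\delta(x)$ denotes the distance from $x\in\Omega$ to $\partial\Omega$. Set $N'=N/(N-1)$ and \[ \Phi_N(u):=\sum_{k\geq N-1}\frac{|u|^{kN'}}{k!}\quad (k \text{ integer}),\qquad M_p(u):=\left(\int_\Omega|\nabla u|^p+\frac{|u|^p}{\delta^p}\right)^{1/p}\quad (1\leq p<\infty). \] Functions are real-valued and integrals are with respect to Lebesgue measure. *)

theory Defs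
  imports "HOL-Analysis.Analysis"
begin

definition partial_deriv :: "'n \<Rightarrow> (real ^ 'n \<Rightarrow> real) \<Rightarrow> real ^ 'n \<Rightarrow> real" where
  "partial_deriv i f x = frechet_derivative f (at x) (axis i 1)"

definition gradient :: "(real ^ 'n \<Rightarrow> real) \<Rightarrow> real ^ 'n \<Rightarrow> real ^ 'n" where
  "gradient f x = (\<chi> i. partial_deriv i f x)"

primrec C_k :: "nat \<Rightarrow> (real ^ 'n \<Rightarrow> real) \<Rightarrow> bool" where
  "C_k 0 f \<longleftrightarrow> continuous_on UNIV f"
| "C_k (Suc k) f \<longleftrightarrow> (\<forall>x. f differentiable (at x)) \<and> (\<forall>i. C_k k (partial_deriv i f))"

text \<open>The space of smooth functions with compact support in \<open>\<Omega>\<close>, each extended by zero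
  to the whole space.\<close>

definition test_functions :: "(real ^ 'n) set \<Rightarrow> (real ^ 'n \<Rightarrow> real) set" where
  "test_functions \<Omega> =
     {\<phi>. (\<forall>k. C_k k \<phi>) \<and> compact (closure {x. \<phi> x \<noteq> 0}) \<and> closure {x. \<phi> x \<noteq> 0} \<subseteq> \<Omega>}"

definition locally_integrable_on ::
    "(real ^ 'n \<Rightarrow> 'b::euclidean_space) \<Rightarrow> (real ^ 'n) set \<Rightarrow> bool" where
  "locally_integrable_on f \<Omega> \<longleftrightarrow>
     (\<forall>K. compact K \<and> K \<subseteq> \<Omega> \<longrightarrow> f absolutely_integrable_on K)"

definition has_weak_gradient ::
    "(real ^ 'n) set \<Rightarrow> (real ^ 'n \<Rightarrow> real) \<Rightarrow> (real ^ 'n \<Rightarrow> real ^ 'n) \<Rightarrow> bool" where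
  "has_weak_gradient \<Omega> u g \<longleftrightarrow>
     locally_integrable_on u \<Omega> \<and> locally_integrable_on g \<Omega> \<and>
     (\<forall>\<phi>\<in>test_functions \<Omega>. \<forall>i.
        (LINT x|lebesgue_on \<Omega>. u x * partial_deriv i \<phi> x)
          = - (LINT x|lebesgue_on \<Omega>. g x $ i * \<phi> x))"

text \<open>A weak gradient on an open set is unique up to a null set, so the choice does not affect
  any of the integrals below.\<close>

definition weak_gradient ::
    "(real ^ 'n) set \<Rightarrow> (real ^ 'n \<Rightarrow> real) \<Rightarrow> real ^ 'n \<Rightarrow> real ^ 'n" where
  "weak_gradient \<Omega> u = (SOME g. has_weak_gradient \<Omega> u g)"

definition Lp_on ::
    "real \<Rightarrow> (real ^ 'n) set \<Rightarrow> (real ^ 'n \<Rightarrow> 'b::euclidean_space) set" where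
  "Lp_on p \<Omega> = {f. f \<in> borel_measurable (lebesgue_on \<Omega>) \<and>
     (\<integral>\<^sup>+x. ennreal (norm (f x) powr p) \<partial>lebesgue_on \<Omega>) < \<infinity>}"

text \<open>Elements of the Sobolev spaces are represented by functions, not by classes of functions
  modulo null sets; values outside \<open>\<Omega>\<close> are irrelevant.\<close>

definition W1 :: "real \<Rightarrow> (real ^ 'n) set \<Rightarrow> (real ^ 'n \<Rightarrow> real) set" where
  "W1 p \<Omega> = {u \<in> Lp_on p \<Omega>. (\<exists>g. has_weak_gradient \<Omega> u g) \<and> weak_gradient \<Omega> u \<in> Lp_on p \<Omega>}"

text \<open>The closure of the test functions in the norm of \<open>W1 p \<Omega>\<close>. The weak gradient of a test
  function is its classical gradient.\<close>

definition W1_0 :: "real \<Rightarrow> (real ^ 'n) set \<Rightarrow> (real ^ 'n \<Rightarrow> real) set" where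
  "W1_0 p \<Omega> = {u \<in> W1 p \<Omega>. \<exists>\<phi>. (\<forall>n::nat. \<phi> n \<in> test_functions \<Omega>) \<and>
     (\<lambda>n. \<integral>\<^sup>+x. ennreal (\<bar>u x - \<phi> n x\<bar> powr p
             + norm (weak_gradient \<Omega> u x - gradient (\<phi> n) x) powr p) \<partial>lebesgue_on \<Omega>)
       \<longlonglongrightarrow> 0}"

definition bdist :: "(real ^ 'n) set \<Rightarrow> real ^ 'n \<Rightarrow> real" where
  "bdist \<Omega> x = infdist x (frontier \<Omega>)"

text \<open>Real powers of extended nonnegative reals, for positive exponents.\<close>

definition epowr :: "ennreal \<Rightarrow> real \<Rightarrow> ennreal" where
  "epowr a r = (if a = \<infinity> then \<infinity> else ennreal (enn2real a powr r))"

definition M :: "real \<Rightarrow> (real ^ 'n) set \<Rightarrow> (real ^ 'n \<Rightarrow> real) \<Rightarrow> ennreal" where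
  "M p \<Omega> u = epowr
     (\<integral>\<^sup>+x. ennreal (norm (weak_gradient \<Omega> u x) powr p + \<bar>u x\<bar> powr p / bdist \<Omega> x powr p)
        \<partial>lebesgue_on \<Omega>) (1 / p)"

definition Phi :: "nat \<Rightarrow> real \<Rightarrow> real" where
  "Phi N t = (\<Sum>\<^sub>\<infinity>k\<in>{N - 1..}. \<bar>t\<bar> powr (real k * (real N / (real N - 1))) / fact k)"

end

theory Submission
  imports Defs
begin

text \<open>
  Write $N$ for the dimension, $N' = N/(N-1)$ and $r(y) = \delta(y)/2$. The inequality is a pointwise
  estimate by averages of an energy density of total mass one, integrated over the domain.

  Averaging the fundamental theorem of calculus over the segments from \<open>y\<close> to \<open>y + r(y) v\<close>, where \<open>v\<close>
  runs through the annulus $1/2 \le |v| \le 1$, bounds $|u(y)|$, up to a constant, by an average of $|u|$ near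
  \<open>y\<close> plus the potential $P(y) = \int_0^1\!\int r(y)\,|\nabla u|(y + t r(y) v)\,dv\,dt$ (\<open>potential_bound\<close>). Because
  \<open>r\<close> is Lipschitz with constant $1/2$, Tonelli's theorem shows that such averages, integrated
  over \<open>y\<close>, are at most a constant times the integral of the averaged function
  (\<open>integral_ring_int_le\<close>, \<open>integral_cone_int_le\<close>); this replaces a Whitney covering. The same
  estimate and Fatou's lemma carry the potential bound from test functions to their limits
  (\<open>AE_potential_bound\<close>): convergence without the weight $\delta^{-N}$ suffices, since the bound
  holds point by point.

  Let $H = |\nabla u|^N + |u|^N/\delta^N$, which has integral one, and let $D(y)$ be $r(y)^N$ times a
  weighted sum of averages of \<open>H\<close> near \<open>y\<close>. The integrand $x = r\,|\nabla u|$ of \<open>P\<close> is controlled in two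
  ways: the integral of $x^N$ is at most $D(y)$, and the integral of $x^N t^{N-1}$ is at most
  $\int H = 1$. Using the first for $t < \tau$ and the second for $t > \tau$ costs
  $(\log (1/\tau))^{1/N'}$, and the choice $\tau \sim 1/(1+D)$ gives
  $P^{N'} \le C (1 + \log (1 + D))$ (\<open>cone_int_log_bound\<close>). Hence $\exp(|u/c_1|^{N'}) \le C (1 + D)$ for a
  suitable $c_1$, while $|u|^N \le C D$ is elementary. The exponential series without its first $N-1$
  terms vanishes like $|u|^N$ at the origin, so the two bounds combine to
  $\Phi_N(u/c_1) \le C D$ (\<open>Phi_bound_of_log_growth\<close>). Finally $D/\delta^N$ is a
  multiple of the averages of \<open>H\<close>, whose integral is bounded by a constant
  (\<open>weighted_Phi_integral_le\<close>).
\<close>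

section \<open>Averages over annuli and truncated cones\<close>

definition annulus :: "'a::euclidean_space set" where
  "annulus = {v. 1/2 \<le> norm v \<and> norm v \<le> 1}"

definition ring_int :: "('a::euclidean_space \<Rightarrow> ennreal) \<Rightarrow> 'a \<Rightarrow> real \<Rightarrow> ennreal" where
  "ring_int f y c = (\<integral>\<^sup>+v. f (y + c *\<^sub>R v) * indicator annulus v \<partial>lborel)"

text \<open>
  In polar form this is integration against $|z|^{1-N}$, up to constants and a cutoff
  near $|z| = c$: the point \<open>y + t c v\<close> with \<open>v\<close> in the annulus lies at distance comparable to \<open>t c\<close>
  from \<open>y\<close>, and $dv\,dt$ carries no factor $t^{N-1}$. Writing the Riesz kernel in this way avoids polar coordinates.
\<close>

definition cone_int :: "('a::euclidean_space \<Rightarrow> ennreal) \<Rightarrow> 'a \<Rightarrow> real \<Rightarrow> ennreal" where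
  "cone_int f y c = (\<integral>\<^sup>+t. ring_int f y (t * c) * indicator {0<..<1} t \<partial>lborel)"

lemma sets_annulus [measurable]: "annulus \<in> sets borel"
  unfolding annulus_def by measurable

lemma ring_int_measurable [measurable (raw)]:
  assumes [measurable]: "f \<in> borel_measurable borel" "a \<in> borel_measurable L"
    "c \<in> borel_measurable L"
  shows "(\<lambda>x. ring_int f (a x) (c x)) \<in> borel_measurable L"
  unfolding ring_int_def by (rule lborel.borel_measurable_nn_integral) measurable

lemma cone_int_measurable [measurable (raw)]:
  assumes [measurable]: "f \<in> borel_measurable borel" "a \<in> borel_measurable L"
    "c \<in> borel_measurable L"
  shows "(\<lambda>x. cone_int f (a x) (c x)) \<in> borel_measurable L"
  unfolding cone_int_def by (rule lborel.borel_measurable_nn_integral) measurable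

lemma ring_int_mono:
  assumes "\<And>v. v \<in> annulus \<Longrightarrow> f (y + c *\<^sub>R v) \<le> g (y + c *\<^sub>R v)"
  shows "ring_int f y c \<le> ring_int g y c"
  unfolding ring_int_def using assms by (intro nn_integral_mono) (auto simp: indicator_def)

lemma cone_int_mono:
  assumes "\<And>w. norm w \<le> \<bar>c\<bar> \<Longrightarrow> f (y + w) \<le> g (y + w)"
  shows "cone_int f y c \<le> cone_int g y c"
proof -
  have "ring_int f y (t * c) \<le> ring_int g y (t * c)" if "0 < t" "t < 1" for t
  proof (rule ring_int_mono)
    fix v :: 'a assume "v \<in> annulus"
    then have "\<bar>t\<bar> * \<bar>c\<bar> * norm v \<le> 1 * \<bar>c\<bar> * 1"
      using that by (intro mult_mono) (auto simp: annulus_def)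
    then show "f (y + (t * c) *\<^sub>R v) \<le> g (y + (t * c) *\<^sub>R v)"
      by (intro assms) (simp add: abs_mult)
  qed
  then show ?thesis
    unfolding cone_int_def by (intro nn_integral_mono) (auto simp: indicator_def)
qed

lemma ring_int_add:
  assumes [measurable]: "f \<in> borel_measurable borel" "g \<in> borel_measurable borel"
  shows "ring_int (\<lambda>x. f x + g x) y c = ring_int f y c + ring_int g y c"
  unfolding ring_int_def by (simp add: distrib_right nn_integral_add)

lemma cone_int_add:
  assumes [measurable]: "f \<in> borel_measurable borel" "g \<in> borel_measurable borel"
  shows "cone_int (\<lambda>x. f x + g x) y c = cone_int f y c + cone_int g y c"
  unfolding cone_int_def by (simp add: ring_int_add distrib_right nn_integral_add)

lemma ring_int_cmult:
  assumes [measurable]: "f \<in> borel_measurable borel"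
  shows "ring_int (\<lambda>x. k * f x) y c = k * ring_int f y c"
  unfolding ring_int_def by (simp add: mult.assoc nn_integral_cmult)

lemma cone_int_cmult:
  assumes [measurable]: "f \<in> borel_measurable borel"
  shows "cone_int (\<lambda>x. k * f x) y c = k * cone_int f y c"
  unfolding cone_int_def by (simp add: ring_int_cmult mult.assoc nn_integral_cmult)

lemma annulus_finite: "emeasure lborel (annulus :: 'a::euclidean_space set) < \<infinity>"
proof -
  have "emeasure lborel (annulus :: 'a set) \<le> emeasure lborel (cball 0 1 :: 'a set)"
    by (intro emeasure_mono) (auto simp: annulus_def)
  then show ?thesis using emeasure_lborel_cball_finite[of "0::'a" 1] by (rule le_less_trans)
qed

abbreviation annulus_vol :: "'a::euclidean_space itself \<Rightarrow> real" where
  "annulus_vol T \<equiv> measure lborel (annulus :: 'a set)"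

lemma emeasure_annulus:
  "emeasure lborel (annulus :: 'a::euclidean_space set) = ennreal (annulus_vol TYPE('a))"
  using annulus_finite[where 'a='a] by (intro emeasure_eq_ennreal_measure) (simp add: less_top)

lemma annulus_vol_pos: "0 < annulus_vol TYPE('a::euclidean_space)"
proof -
  obtain b :: 'a where b: "b \<in> Basis" using nonempty_Basis by blast
  have "ball ((3/4) *\<^sub>R b) (1/4) \<subseteq> annulus"
  proof
    fix x assume "x \<in> ball ((3/4) *\<^sub>R b) (1/4)"
    then have "norm ((3/4) *\<^sub>R b - x) < 1/4" by (simp add: dist_norm)
    moreover have "norm ((3/4) *\<^sub>R b) = 3/4" using b by simp
    ultimately show "x \<in> annulus"
      unfolding annulus_def using norm_triangle_ineq2[of "(3/4) *\<^sub>R b" x]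
        norm_triangle_ineq2[of x "(3/4) *\<^sub>R b"] by (simp add: norm_minus_commute)
  qed
  then have "measure lborel (ball ((3/4) *\<^sub>R b) (1/4)) \<le> annulus_vol TYPE('a)"
    using annulus_finite by (intro measure_mono_fmeasurable) (auto simp: fmeasurable_def)
  moreover have "0 < measure lborel (ball ((3/4) *\<^sub>R b) (1/4))"
    by (simp add: content_ball)
  ultimately show ?thesis by linarith
qed

lemma ring_int_const: "ring_int (\<lambda>_. k) (y::'a::euclidean_space) c = k * ennreal (annulus_vol TYPE('a))"
  by (simp add: ring_int_def nn_integral_cmult_indicator emeasure_annulus)

lemma cone_int_const: "cone_int (\<lambda>_. k) (y::'a::euclidean_space) c = k * ennreal (annulus_vol TYPE('a))"
  by (simp add: cone_int_def ring_int_const nn_integral_cmult_indicator)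

lemma ring_int_eq_integral_shell:
  fixes y :: "'a::euclidean_space"
  assumes [measurable]: "f \<in> borel_measurable borel" and "0 < c"
  shows "ring_int f y c = ennreal ((1 / c) ^ DIM('a)) *
    (\<integral>\<^sup>+z. f z * indicator {z. c / 2 \<le> dist y z \<and> dist y z \<le> c} z \<partial>lborel)"
proof -
  let ?g = "\<lambda>z. f z * indicator {z. c / 2 \<le> dist y z \<and> dist y z \<le> c} z"
  have [measurable]: "?g \<in> borel_measurable borel" by measurable
  have "(\<integral>\<^sup>+z. ?g z \<partial>lborel)
      = (\<integral>\<^sup>+z. ?g z \<partial>density (distr lborel borel (\<lambda>x. y + c *\<^sub>R x)) (\<lambda>_. ennreal (\<bar>c\<bar> ^ DIM('a))))"
    using lborel_affine[of c y] assms by simp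
  also have "\<dots> = ennreal (c ^ DIM('a)) * (\<integral>\<^sup>+v. ?g (y + c *\<^sub>R v) \<partial>lborel)"
    using assms by (simp add: nn_integral_density nn_integral_distr nn_integral_cmult)
  also have "(\<integral>\<^sup>+v. ?g (y + c *\<^sub>R v) \<partial>lborel) = ring_int f y c"
    unfolding ring_int_def using assms
    by (intro nn_integral_cong) (auto simp: indicator_def annulus_def dist_norm field_simps)
  finally have "(\<integral>\<^sup>+z. ?g z \<partial>lborel) = ennreal (c ^ DIM('a)) * ring_int f y c" .
  moreover have "ennreal ((1 / c) ^ DIM('a)) * ennreal (c ^ DIM('a)) = 1"
    using assms by (simp flip: ennreal_mult power_mult_distrib)
  ultimately show ?thesis by (simp flip: mult.assoc)
qed

lemma ring_int_le_integral_cball: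
  fixes y :: "'a::euclidean_space"
  assumes [measurable]: "f \<in> borel_measurable borel" and "0 < c"
  shows "ennreal (c ^ DIM('a)) * ring_int f y c \<le> (\<integral>\<^sup>+z. f z * indicator (cball y c) z \<partial>lborel)"
proof -
  have "ennreal (c ^ DIM('a)) * ennreal ((1 / c) ^ DIM('a)) = 1"
    using assms by (simp flip: ennreal_mult power_mult_distrib)
  then have "ennreal (c ^ DIM('a)) * ring_int f y c
      = (\<integral>\<^sup>+z. f z * indicator {z. c / 2 \<le> dist y z \<and> dist y z \<le> c} z \<partial>lborel)"
    using assms by (simp add: ring_int_eq_integral_shell flip: mult.assoc)
  also have "\<dots> \<le> (\<integral>\<^sup>+z. f z * indicator (cball y c) z \<partial>lborel)"
    by (intro nn_integral_mono) (auto simp: indicator_def)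
  finally show ?thesis .
qed

text \<open>
  The weight turns $dv\,dt$ into $t^{-1}\,dz\,dt$ under the substitution \<open>z = y + t c v\<close>. A given \<open>z\<close>
  at distance \<open>s c\<close> from \<open>y\<close> is seen only for $s \le t \le 2s$, an interval on which $t^{-1}$ has
  integral at most one. Averaging over an annulus instead of a ball is what makes this interval
  short, and it is the reason for the lower bound $1/2$ in the annulus.
\<close>

lemma weighted_cone_le_integral_cball:
  fixes y :: "'a::euclidean_space"
  assumes [measurable]: "f \<in> borel_measurable borel" and c: "0 < c"
  shows "ennreal (c ^ DIM('a)) *
      (\<integral>\<^sup>+t. ennreal (t ^ (DIM('a) - 1)) * ring_int f y (t * c) * indicator {0<..<1} t \<partial>lborel)
    \<le> (\<integral>\<^sup>+z. f z * indicator (cball y c) z \<partial>lborel)"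
proof -
  let ?N = "DIM('a)"
  let ?S = "\<lambda>t. {z. t * c / 2 \<le> dist y z \<and> dist y z \<le> t * c}"
  let ?h = "\<lambda>t z. ennreal (1 / t) * indicator {0<..<1} t * (f z * indicator (?S t) z)"
  have eq: "ennreal (c ^ ?N) * (ennreal (t ^ (?N - 1)) * ring_int f y (t * c) * indicator {0<..<1} t)
      = (\<integral>\<^sup>+z. ?h t z \<partial>lborel)" for t :: real
  proof (cases "0 < t \<and> t < 1")
    case True
    have N: "t ^ ?N = t * t ^ (?N - 1)"
      by (metis DIM_positive power_eq_if less_numeral_extra(3))
    have "c ^ ?N * (t ^ (?N - 1) * (1 / (t * c)) ^ ?N) = 1 / t"
      using True c N by (simp add: power_divide power_mult_distrib field_simps)
    then have "ennreal (c ^ ?N) * (ennreal (t ^ (?N - 1)) * ennreal ((1 / (t * c)) ^ ?N)) = ennreal (1 / t)"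
      using True c by (simp flip: ennreal_mult)
    then have "ennreal (c ^ ?N) * (ennreal (t ^ (?N - 1)) *
        (ennreal ((1 / (t * c)) ^ ?N) * (\<integral>\<^sup>+z. f z * indicator (?S t) z \<partial>lborel)))
        = ennreal (1 / t) * (\<integral>\<^sup>+z. f z * indicator (?S t) z \<partial>lborel)"
      by (simp flip: mult.assoc)
    moreover have "(\<integral>\<^sup>+z. ?h t z \<partial>lborel) = ennreal (1 / t) * (\<integral>\<^sup>+z. f z * indicator (?S t) z \<partial>lborel)"
      using True by (simp add: nn_integral_cmult)
    ultimately show ?thesis
      using True c by (simp add: ring_int_eq_integral_shell)
  qed (auto simp: indicator_def)
  have [measurable]: "(\<lambda>(t, z). ?h t z) \<in> borel_measurable (lborel \<Otimes>\<^sub>M lborel)"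
    by (simp add: indicator_def split_def) measurable
  have inner: "(\<integral>\<^sup>+t. ?h t z \<partial>lborel) \<le> f z * indicator (cball y c) z" for z
  proof (cases "0 < dist y z \<and> dist y z \<le> c")
    case True
    let ?s = "dist y z / c"
    have s: "0 < ?s" using True c by simp
    have "(\<integral>\<^sup>+t. ?h t z \<partial>lborel) \<le> (\<integral>\<^sup>+t. (f z * ennreal (1 / ?s)) * indicator {?s..2 * ?s} t \<partial>lborel)"
    proof (rule nn_integral_mono)
      fix t
      show "?h t z \<le> (f z * ennreal (1 / ?s)) * indicator {?s..2 * ?s} t"
      proof (cases "0 < t \<and> z \<in> ?S t")
        case t: True
        then have "?s \<le> t" "t \<le> 2 * ?s" using c by (auto simp: field_simps)
        moreover then have "1 / t \<le> 1 / ?s" using s by (intro frac_le) auto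
        ultimately show ?thesis
          by (auto simp: indicator_def mult.commute intro!: mult_left_mono ennreal_leI)
      qed (auto simp: indicator_def)
    qed
    also have "\<dots> = f z * (ennreal (1 / ?s) * ennreal ?s)"
      using s by (subst nn_integral_cmult_indicator) (simp_all add: mult.assoc)
    also have "ennreal (1 / ?s) * ennreal ?s = ennreal (1 / ?s * ?s)"
      using True c by (intro ennreal_mult [symmetric]) auto
    also have "1 / ?s * ?s = 1" using s by (intro nonzero_eq_divide_eq [THEN iffD1]) auto
    finally show ?thesis using True by simp
  next
    case False
    then have "?h t z = 0" for t
    proof (cases "0 < t \<and> t < 1 \<and> z \<in> ?S t")
      case True
      then have "0 < t * c" "t * c \<le> 1 * c" using c by (auto intro!: mult_right_mono)
      then have "0 < dist y z \<and> dist y z \<le> c" using True by auto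
      with False show ?thesis by simp
    qed (auto simp: indicator_def)
    then have "(\<integral>\<^sup>+t. ?h t z \<partial>lborel) = (\<integral>\<^sup>+(t::real). 0 \<partial>lborel)"
      by (intro nn_integral_cong)
    then show ?thesis by simp
  qed
  have "ennreal (c ^ ?N) *
      (\<integral>\<^sup>+t. ennreal (t ^ (?N - 1)) * ring_int f y (t * c) * indicator {0<..<1} t \<partial>lborel)
    = (\<integral>\<^sup>+t. (\<integral>\<^sup>+z. ?h t z \<partial>lborel) \<partial>lborel)"
    unfolding eq [symmetric] by (rule nn_integral_cmult [symmetric]) measurable
  also have "\<dots> = (\<integral>\<^sup>+z. (\<integral>\<^sup>+t. ?h t z \<partial>lborel) \<partial>lborel)"
    by (rule lborel_pair.Fubini') measurable
  also have "\<dots> \<le> (\<integral>\<^sup>+z. f z * indicator (cball y c) z \<partial>lborel)"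
    by (intro nn_integral_mono inner)
  finally show ?thesis .
qed

section \<open>Averages at the scale of the distance to the boundary\<close>

text \<open>
  The factor $1/2$ serves twice: closed balls of this radius stay inside \<open>\<Omega>\<close>, and the Lipschitz
  constant $1/2$ makes the radii at any two points of such a ball comparable.
\<close>

definition half_bdist :: "'a::euclidean_space set \<Rightarrow> 'a \<Rightarrow> real" where
  "half_bdist \<Omega> x = infdist x (frontier \<Omega>) / 2"

lemma half_bdist_measurable [measurable]: "half_bdist \<Omega> \<in> borel_measurable borel"
  unfolding half_bdist_def [abs_def]
  by (intro borel_measurable_continuous_onI continuous_intros) simp

lemma half_bdist_Lipschitz: "half_bdist \<Omega> x \<le> half_bdist \<Omega> y + dist x y / 2"
  using infdist_triangle[of x "frontier \<Omega>" y] by (simp add: half_bdist_def)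

lemma half_bdist_pos:
  assumes "open \<Omega>" "frontier \<Omega> \<noteq> {}" "x \<in> \<Omega>"
  shows "0 < half_bdist \<Omega> x"
proof -
  have "x \<notin> frontier \<Omega>" using assms by (simp add: frontier_def interior_open)
  then show ?thesis
    using assms by (simp add: half_bdist_def infdist_pos_not_in_closed)
qed

text \<open>
  A ball that leaves \<open>\<Omega>\<close> is connected and hence meets the frontier, but the frontier is at
  distance \<open>2 * half_bdist \<Omega> x\<close>.
\<close>

lemma cball_half_bdist_subset:
  assumes "open \<Omega>" "frontier \<Omega> \<noteq> {}" "x \<in> \<Omega>"
  shows "cball x (half_bdist \<Omega> x) \<subseteq> \<Omega>"
proof (rule ccontr)
  assume "\<not> ?thesis"
  moreover have "x \<in> cball x (half_bdist \<Omega> x)"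
    using half_bdist_pos[OF assms] by simp
  ultimately have "cball x (half_bdist \<Omega> x) \<inter> frontier \<Omega> \<noteq> {}"
    using assms(3) by (intro connected_Int_frontier) (simp, blast, blast)
  then obtain z where z: "z \<in> frontier \<Omega>" "dist x z \<le> half_bdist \<Omega> x" by auto
  then have "2 * half_bdist \<Omega> x \<le> half_bdist \<Omega> x"
    using infdist_le[of z "frontier \<Omega>" x] by (simp add: half_bdist_def)
  then show False using half_bdist_pos[OF assms] by simp
qed

text \<open>
  The factor $3$ compares the scales at two points of which one lies in the other's ball: there
  $\tfrac23 r(z) \le r(y) \le 2 r(z)$, and the quotient of these bounds is $3$.
\<close>

abbreviation Tonelli_const :: "'a::euclidean_space itself \<Rightarrow> real" where
  "Tonelli_const T \<equiv> unit_ball_vol (real DIM('a)) * 3 ^ DIM('a)"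

text \<open>
  After the substitution \<open>z = y + t r(y) v\<close> and an exchange of integrals, each \<open>z\<close> receives mass from
  the \<open>y\<close> within distance $t r(y)$. The Lipschitz bound on \<open>r\<close> replaces $r(y)$ by $r(z)$ up to constants, so
  these \<open>y\<close> lie in a ball of radius at most $2 t r(z)$ and are weighted by at most $(\tfrac23 t r(z))^{-N}$.
\<close>

lemma integral_ring_int_le:
  fixes \<Omega> :: "'a::euclidean_space set"
  assumes \<Omega>: "open \<Omega>" "frontier \<Omega> \<noteq> {}"
    and [measurable]: "f \<in> borel_measurable borel" and t: "0 < t" "t \<le> 1"
  shows "(\<integral>\<^sup>+y. ring_int f y (t * half_bdist \<Omega> y) * indicator \<Omega> y \<partial>lborel)
    \<le> ennreal (Tonelli_const TYPE('a)) * (\<integral>\<^sup>+z. f z * indicator \<Omega> z \<partial>lborel)"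
proof -
  let ?N = "DIM('a)" and ?r = "half_bdist \<Omega>"
  have [measurable]: "\<Omega> \<in> sets borel" using \<Omega> by simp
  let ?S = "\<lambda>y. {z. t * ?r y / 2 \<le> dist y z \<and> dist y z \<le> t * ?r y}"
  let ?h = "\<lambda>y z. ennreal ((1 / (t * ?r y)) ^ ?N) * indicator \<Omega> y * (f z * indicator (?S y) z)"
  have eq: "ring_int f y (t * ?r y) * indicator \<Omega> y = (\<integral>\<^sup>+z. ?h y z \<partial>lborel)" for y
  proof (cases "y \<in> \<Omega>")
    case True
    then have "0 < t * ?r y" using half_bdist_pos[OF \<Omega>] t by simp
    then show ?thesis using True by (simp add: ring_int_eq_integral_shell nn_integral_cmult)
  qed simp
  have [measurable]: "(\<lambda>(y, z). ?h y z) \<in> borel_measurable (lborel \<Otimes>\<^sub>M lborel)"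
    by (simp add: indicator_def split_def) measurable
  have inner: "(\<integral>\<^sup>+y. ?h y z \<partial>lborel)
      \<le> ennreal (Tonelli_const TYPE('a)) * (f z * indicator \<Omega> z)" for z
  proof -
    let ?B = "cball z (2 * t * ?r z)"
    let ?k = "(1 / (t * (2 / 3 * ?r z))) ^ ?N"
    have le: "?h y z \<le> (ennreal ?k * (f z * indicator \<Omega> z)) * indicator ?B y" for y
    proof (cases "y \<in> \<Omega> \<and> z \<in> ?S y")
      case True
      have r: "0 < ?r y" using True half_bdist_pos[OF \<Omega>] by simp
      have "t * ?r y \<le> ?r y" using r t by (simp add: mult_left_le_one_le)
      then have d: "dist y z \<le> ?r y" using True by auto
      then have z: "z \<in> \<Omega>" using cball_half_bdist_subset[OF \<Omega>, of y] True by auto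
      have yz: "?r y \<le> 2 * ?r z"
        using half_bdist_Lipschitz[of \<Omega> y z] d by simp
      have zy: "2 / 3 * ?r z \<le> ?r y"
        using half_bdist_Lipschitz[of \<Omega> z y] d by (simp add: dist_commute)
      have "dist y z \<le> t * ?r y" using True by simp
      also have "\<dots> \<le> t * (2 * ?r z)" using yz t by (intro mult_left_mono) auto
      finally have B: "y \<in> ?B" by (simp add: dist_commute)
      have rz: "0 < ?r z" using half_bdist_pos[OF \<Omega> z] .
      have "(1 / (t * ?r y)) ^ ?N \<le> ?k"
        using t r rz zy by (intro power_mono divide_left_mono mult_left_mono mult_pos_pos) auto
      then show ?thesis using True z B
        by (auto simp: indicator_def intro!: mult_right_mono ennreal_leI)
    qed (auto simp: indicator_def)
    have "(\<integral>\<^sup>+y. ?h y z \<partial>lborel)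
        \<le> (\<integral>\<^sup>+y. (ennreal ?k * (f z * indicator \<Omega> z)) * indicator ?B y \<partial>lborel)"
      by (intro nn_integral_mono le)
    also have "\<dots> = (ennreal ?k * (f z * indicator \<Omega> z)) * emeasure lborel ?B"
      by (simp add: nn_integral_cmult_indicator)
    also have "\<dots> = ennreal (Tonelli_const TYPE('a)) * (f z * indicator \<Omega> z)"
    proof (cases "z \<in> \<Omega>")
      case True
      then have r: "0 < ?r z" using half_bdist_pos[OF \<Omega>] by simp
      have "1 / (t * (2 / 3 * ?r z)) * (2 * t * ?r z) = 3"
        using r t by (simp add: field_simps)
      then have k: "?k * (2 * t * ?r z) ^ ?N = 3 ^ ?N"
        by (simp only: power_mult_distrib [symmetric])
      have "?k * (unit_ball_vol (real ?N) * (2 * t * ?r z) ^ ?N)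
          = unit_ball_vol (real ?N) * (?k * (2 * t * ?r z) ^ ?N)"
        by (rule mult.left_commute)
      then have k': "?k * (unit_ball_vol (real ?N) * (2 * t * ?r z) ^ ?N) = Tonelli_const TYPE('a)"
        unfolding k .
      have "ennreal ?k * emeasure lborel ?B
          = ennreal (?k * (unit_ball_vol (real ?N) * (2 * t * ?r z) ^ ?N))"
        using r t by (subst emeasure_cball, simp, subst ennreal_mult) simp_all
      then have m: "ennreal ?k * emeasure lborel ?B = ennreal (Tonelli_const TYPE('a))"
        unfolding k' .
      have "(ennreal ?k * (f z * indicator \<Omega> z)) * emeasure lborel ?B
          = (ennreal ?k * emeasure lborel ?B) * (f z * indicator \<Omega> z)"
        by (simp only: mult_ac)
      then show ?thesis unfolding m .
    qed simp
    finally show ?thesis .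
  qed
  have "(\<integral>\<^sup>+y. ring_int f y (t * ?r y) * indicator \<Omega> y \<partial>lborel)
      = (\<integral>\<^sup>+y. (\<integral>\<^sup>+z. ?h y z \<partial>lborel) \<partial>lborel)"
    by (simp add: eq)
  also have "\<dots> = (\<integral>\<^sup>+z. (\<integral>\<^sup>+y. ?h y z \<partial>lborel) \<partial>lborel)"
    by (rule lborel_pair.Fubini') measurable
  also have "\<dots> \<le> (\<integral>\<^sup>+z. ennreal (Tonelli_const TYPE('a)) * (f z * indicator \<Omega> z) \<partial>lborel)"
    by (intro nn_integral_mono inner)
  also have "\<dots> = ennreal (Tonelli_const TYPE('a)) * (\<integral>\<^sup>+z. f z * indicator \<Omega> z \<partial>lborel)"
    by (rule nn_integral_cmult) measurable
  finally show ?thesis .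
qed

lemma integral_cone_int_le:
  fixes \<Omega> :: "'a::euclidean_space set"
  assumes \<Omega>: "open \<Omega>" "frontier \<Omega> \<noteq> {}"
    and [measurable]: "f \<in> borel_measurable borel"
  shows "(\<integral>\<^sup>+y. cone_int f y (half_bdist \<Omega> y) * indicator \<Omega> y \<partial>lborel)
    \<le> ennreal (Tonelli_const TYPE('a)) * (\<integral>\<^sup>+z. f z * indicator \<Omega> z \<partial>lborel)"
proof -
  let ?r = "half_bdist \<Omega>" and ?K = "ennreal (Tonelli_const TYPE('a)) * (\<integral>\<^sup>+z. f z * indicator \<Omega> z \<partial>lborel)"
  have [measurable]: "\<Omega> \<in> sets borel" using \<Omega> by simp
  let ?h = "\<lambda>y t. ring_int f y (t * ?r y) * indicator {0<..<1} t * indicator \<Omega> y"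
  have [measurable]: "(\<lambda>(y, t). ?h y t) \<in> borel_measurable (lborel \<Otimes>\<^sub>M lborel)"
    by (simp add: split_def) measurable
  have "(\<integral>\<^sup>+y. cone_int f y (?r y) * indicator \<Omega> y \<partial>lborel)
      = (\<integral>\<^sup>+y. (\<integral>\<^sup>+t. ?h y t \<partial>lborel) \<partial>lborel)"
    by (simp add: cone_int_def nn_integral_multc)
  also have "\<dots> = (\<integral>\<^sup>+t. (\<integral>\<^sup>+y. ?h y t \<partial>lborel) \<partial>lborel)"
    by (rule lborel_pair.Fubini') measurable
  also have "\<dots> \<le> (\<integral>\<^sup>+(t::real). ?K * indicator {0<..<1} t \<partial>lborel)"
  proof (rule nn_integral_mono)
    fix t :: real
    show "(\<integral>\<^sup>+y. ?h y t \<partial>lborel) \<le> ?K * indicator {0<..<1} t"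
      using integral_ring_int_le[OF \<Omega> assms(3), of t]
      by (cases "t \<in> {0<..<1}") simp_all
  qed
  also have "\<dots> = ?K" by (simp add: nn_integral_cmult_indicator)
  finally show ?thesis .
qed

section \<open>A potential bound for smooth functions\<close>

lemma has_derivative_gradient:
  fixes \<phi> :: "real ^ 'n::finite \<Rightarrow> real"
  assumes "\<phi> differentiable (at x)"
  shows "(\<phi> has_derivative (\<lambda>h. gradient \<phi> x \<bullet> h)) (at x)"
proof -
  let ?D = "frechet_derivative \<phi> (at x)"
  have D: "(\<phi> has_derivative ?D) (at x)" using assms by (simp add: frechet_derivative_works)
  then have lin: "linear ?D" by (rule has_derivative_linear)
  have "?D h = gradient \<phi> x \<bullet> h" for h
  proof -
    have "?D h = ?D (\<Sum>i\<in>UNIV. (h $ i) *\<^sub>R axis i 1)"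
      using basis_expansion[of h] by (simp add: scalar_mult_eq_scaleR)
    also have "\<dots> = (\<Sum>i\<in>UNIV. h $ i * ?D (axis i 1))"
      using lin by (simp add: linear_sum linear_scale o_def)
    finally show ?thesis by (simp add: gradient_def partial_deriv_def inner_vec_def mult.commute)
  qed
  then have "?D = (\<lambda>h. gradient \<phi> x \<bullet> h)" by blast
  with D show ?thesis by simp
qed

lemma test_function_C1:
  fixes \<phi> :: "real ^ 'n::finite \<Rightarrow> real"
  assumes "\<phi> \<in> test_functions \<Omega>"
  shows "\<And>x. \<phi> differentiable (at x)" "continuous_on UNIV \<phi>" "continuous_on UNIV (gradient \<phi>)"
proof -
  have C: "C_k k \<phi>" for k using assms by (simp add: test_functions_def)
  show "\<phi> differentiable (at x)" for x using C[of "Suc 0"] by simp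
  show "continuous_on UNIV \<phi>" using C[of 0] by simp
  have "continuous_on UNIV (partial_deriv i \<phi>)" for i using C[of "Suc 0"] by simp
  then show "continuous_on UNIV (gradient \<phi>)"
    unfolding gradient_def [abs_def] by (intro continuous_on_vec_lambda)
qed

lemma segment_bound:
  fixes \<phi> :: "real ^ 'n::finite \<Rightarrow> real"
  assumes diff: "\<And>x. \<phi> differentiable (at x)" and cont: "continuous_on UNIV (gradient \<phi>)"
  shows "ennreal \<bar>\<phi> y\<bar> \<le> ennreal \<bar>\<phi> (y + w)\<bar> +
    (\<integral>\<^sup>+t. ennreal (norm w * norm (gradient \<phi> (y + t *\<^sub>R w))) * indicator {0<..<1} t \<partial>lborel)"
proof -
  have c: "continuous_on A (\<lambda>t. gradient \<phi> (y + t *\<^sub>R w))" for A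
    by (intro continuous_on_compose2[OF cont] continuous_intros) auto
  have "((\<lambda>t. gradient \<phi> (y + t *\<^sub>R w) \<bullet> w) has_integral
      (\<phi> (y + 1 *\<^sub>R w) - \<phi> (y + 0 *\<^sub>R w))) {0..1}"
  proof (rule fundamental_theorem_of_calculus)
    fix t :: real
    have "((\<lambda>t. y + t *\<^sub>R w) has_derivative (\<lambda>s. s *\<^sub>R w)) (at t within {0..1})"
      by (auto intro!: derivative_eq_intros)
    from has_derivative_compose[OF this has_derivative_gradient[OF diff]]
    show "((\<lambda>t. \<phi> (y + t *\<^sub>R w)) has_vector_derivative gradient \<phi> (y + t *\<^sub>R w) \<bullet> w) (at t within {0..1})"
      by (simp add: has_vector_derivative_def)
  qed simp
  moreover define I where "I = integral {0..1} (\<lambda>t. norm w * norm (gradient \<phi> (y + t *\<^sub>R w)))"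
  have I: "((\<lambda>t. norm w * norm (gradient \<phi> (y + t *\<^sub>R w))) has_integral I) {0..1}"
    unfolding I_def by (intro integrable_integral integrable_continuous_interval continuous_intros c)
  ultimately have "norm (\<phi> (y + 1 *\<^sub>R w) - \<phi> (y + 0 *\<^sub>R w)) \<le> I"
  proof -
    assume J: "((\<lambda>t. gradient \<phi> (y + t *\<^sub>R w) \<bullet> w) has_integral
      (\<phi> (y + 1 *\<^sub>R w) - \<phi> (y + 0 *\<^sub>R w))) {0..1}"
    have "norm (gradient \<phi> (y + t *\<^sub>R w) \<bullet> w) \<le> norm w * norm (gradient \<phi> (y + t *\<^sub>R w))" for t
      using Cauchy_Schwarz_ineq2[of "gradient \<phi> (y + t *\<^sub>R w)" w] by (simp add: mult.commute)
    from has_integral_norm_bound_integral_component[where k=1, OF J I] this show ?thesis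
      by simp
  qed
  then have "\<bar>\<phi> y\<bar> \<le> \<bar>\<phi> (y + w)\<bar> + I" by simp
  moreover have I0: "0 \<le> I" using I by (rule has_integral_nonneg) simp
  moreover have "(\<integral>\<^sup>+t. ennreal (norm w * norm (gradient \<phi> (y + t *\<^sub>R w))) * indicator {0<..<1} t \<partial>lborel)
      = ennreal I"
  proof -
    have "((\<lambda>t. norm w * norm (gradient \<phi> (y + t *\<^sub>R w))) has_integral I) {0<..<1}"
      using I by (simp add: has_integral_Icc_iff_Ioo)
    from nn_integral_has_integral_lebesgue[OF _ this] show ?thesis
      by (simp add: nn_integral_completion ennreal_mult' ennreal_indicator mult.commute)
  qed
  ultimately show ?thesis by (simp flip: ennreal_plus)
qed

text \<open>
  The segment bound is averaged over the endpoint \<open>w = c v\<close>.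
\<close>

lemma potential_bound:
  fixes \<phi> :: "real ^ 'n::finite \<Rightarrow> real"
  assumes "\<And>x. \<phi> differentiable (at x)" "continuous_on UNIV (gradient \<phi>)" "continuous_on UNIV \<phi>"
    and c: "0 \<le> c"
  shows "ennreal (annulus_vol TYPE(real ^ 'n) * \<bar>\<phi> y\<bar>)
    \<le> ring_int (\<lambda>x. ennreal \<bar>\<phi> x\<bar>) y c + cone_int (\<lambda>x. ennreal (c * norm (gradient \<phi> x))) y c"
proof -
  have [measurable]: "\<phi> \<in> borel_measurable borel" "gradient \<phi> \<in> borel_measurable borel"
    using assms by (auto intro: borel_measurable_continuous_onI)
  let ?g = "\<lambda>v t. ennreal (c * norm (gradient \<phi> (y + (t * c) *\<^sub>R v))) * indicator annulus v * indicator {0<..<1} t"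
  have pt: "ennreal \<bar>\<phi> y\<bar> * indicator annulus v
      \<le> ennreal \<bar>\<phi> (y + c *\<^sub>R v)\<bar> * indicator annulus v + (\<integral>\<^sup>+t. ?g v t \<partial>lborel)" for v
  proof (cases "v \<in> annulus")
    case True
    then have "c * norm v \<le> c" using c by (simp add: annulus_def mult_left_le)
    then have "(\<integral>\<^sup>+t. ennreal (norm (c *\<^sub>R v) * norm (gradient \<phi> (y + t *\<^sub>R (c *\<^sub>R v)))) * indicator {0<..<1} t \<partial>lborel)
        \<le> (\<integral>\<^sup>+t. ?g v t \<partial>lborel)"
      using True c
      by (intro nn_integral_mono mult_right_mono) (auto intro!: ennreal_leI mult_right_mono)
    from order_trans[OF segment_bound[OF assms(1,2)] add_left_mono[OF this]] show ?thesis
      using True by simp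
  qed simp
  have "ennreal (annulus_vol TYPE(real ^ 'n) * \<bar>\<phi> y\<bar>)
      = (\<integral>\<^sup>+v. ennreal \<bar>\<phi> y\<bar> * indicator (annulus :: (real ^ 'n) set) v \<partial>lborel)"
    by (subst nn_integral_cmult_indicator) (simp_all add: emeasure_annulus ennreal_mult mult.commute)
  also have "\<dots> \<le> (\<integral>\<^sup>+v. ennreal \<bar>\<phi> (y + c *\<^sub>R v)\<bar> * indicator annulus v + (\<integral>\<^sup>+t. ?g v t \<partial>lborel) \<partial>lborel)"
    by (intro nn_integral_mono pt)
  also have "\<dots> = ring_int (\<lambda>x. ennreal \<bar>\<phi> x\<bar>) y c + (\<integral>\<^sup>+v. (\<integral>\<^sup>+t. ?g v t \<partial>lborel) \<partial>lborel)"
    unfolding ring_int_def by (rule nn_integral_add) measurable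
  also have "(\<integral>\<^sup>+v. (\<integral>\<^sup>+t. ?g v t \<partial>lborel) \<partial>lborel) = (\<integral>\<^sup>+t. (\<integral>\<^sup>+v. ?g v t \<partial>lborel) \<partial>lborel)"
    by (rule lborel_pair.Fubini') measurable
  also have "\<dots> = cone_int (\<lambda>x. ennreal (c * norm (gradient \<phi> x))) y c"
    by (simp add: cone_int_def ring_int_def nn_integral_multc)
  finally show ?thesis .
qed

section \<open>Passage to Sobolev functions\<close>

text \<open>
  An elementary substitute for the inequalities of Hoelder and Young: splitting at the threshold
  \<open>\<eta>\<close>, which stays free and is chosen afterwards, trades a linear expression for an \<open>N\<close>-th power.
\<close>

lemma le_add_power_over:
  fixes x \<eta> :: real
  assumes "0 \<le> x" "0 < \<eta>" "0 < N"
  shows "x \<le> \<eta> + x ^ N / \<eta> ^ (N - 1)"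
proof (cases "x \<le> \<eta>")
  case True
  then show ?thesis using assms by (simp add: add_increasing2)
next
  case False
  have "x * \<eta> ^ (N - 1) \<le> x * x ^ (N - 1)"
    using False assms by (intro mult_left_mono power_mono) auto
  also have "\<dots> = x ^ N" using assms by (simp add: power_eq_if)
  finally have "x \<le> x ^ N / \<eta> ^ (N - 1)" using assms by (simp add: field_simps)
  then show ?thesis using assms by simp
qed

text \<open>
  The error \<open>e\<close> collects the \<open>N\<close>-th powers of the distances from \<open>\<phi>\<close> to \<open>U\<close> and from its gradient
  norm to \<open>G\<close>. Smallness of its averages at the single point \<open>y\<close> transfers the potential bound
  from \<open>\<phi>\<close> to \<open>(U, G)\<close> at that point.
\<close>

lemma potential_bound_perturbed:
  fixes \<phi> U G :: "real ^ 'n::finite \<Rightarrow> real"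
  defines "N \<equiv> CARD('n)" and "\<sigma> \<equiv> annulus_vol TYPE(real ^ 'n)"
  defines "e \<equiv> \<lambda>z. ennreal (\<bar>U z - \<phi> z\<bar> ^ N + \<bar>norm (gradient \<phi> z) - G z\<bar> ^ N)"
  assumes [measurable]: "U \<in> borel_measurable borel" "G \<in> borel_measurable borel"
    and G: "\<And>z. 0 \<le> G z" and \<phi>: "\<phi> \<in> test_functions \<Omega>" and c: "0 \<le> c" and \<eta>: "0 < \<eta>"
    and E: "e y + ring_int e y c + cone_int e y c \<le> ennreal (\<eta> ^ N)"
  shows "ennreal (\<sigma> * \<bar>U y\<bar>) \<le> ring_int (\<lambda>z. ennreal \<bar>U z\<bar>) y c
    + cone_int (\<lambda>z. ennreal (c * G z)) y c + ennreal ((3 * \<sigma> + \<sigma> * c + 1 + c) * \<eta>)"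
proof -
  have [measurable]: "\<phi> \<in> borel_measurable borel" "gradient \<phi> \<in> borel_measurable borel"
    using test_function_C1[OF \<phi>] by (auto intro: borel_measurable_continuous_onI)
  have [measurable]: "e \<in> borel_measurable borel" unfolding e_def by measurable
  define k where "k = 1 / \<eta> ^ (N - 1)"
  have k: "0 \<le> k" using \<eta> by (simp add: k_def)
  have N: "0 < N" by (simp add: N_def)
  have \<sigma>: "0 < \<sigma>" unfolding \<sigma>_def by (rule annulus_vol_pos)
  define a where "a z = \<bar>U z - \<phi> z\<bar> ^ N + \<bar>norm (gradient \<phi> z) - G z\<bar> ^ N" for z
  have a: "0 \<le> a z" for z by (simp add: a_def)
  have e: "e z = ennreal (a z)" for z by (simp add: e_def a_def)
  have dU: "\<bar>U z - \<phi> z\<bar> \<le> \<eta> + k * a z" for z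
  proof -
    have "\<bar>U z - \<phi> z\<bar> \<le> \<eta> + k * \<bar>U z - \<phi> z\<bar> ^ N"
      using le_add_power_over[of "\<bar>U z - \<phi> z\<bar>" \<eta> N] \<eta> N by (simp add: k_def)
    also have "\<dots> \<le> \<eta> + k * a z"
      using k by (intro add_left_mono mult_left_mono) (auto simp: a_def)
    finally show ?thesis .
  qed
  have dG: "\<bar>norm (gradient \<phi> z) - G z\<bar> \<le> \<eta> + k * a z" for z
  proof -
    have "\<bar>norm (gradient \<phi> z) - G z\<bar> \<le> \<eta> + k * \<bar>norm (gradient \<phi> z) - G z\<bar> ^ N"
      using le_add_power_over[of "\<bar>norm (gradient \<phi> z) - G z\<bar>" \<eta> N] \<eta> N by (simp add: k_def)
    also have "\<dots> \<le> \<eta> + k * a z"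
      using k by (intro add_left_mono mult_left_mono) (auto simp: a_def)
    finally show ?thesis .
  qed
  have "ring_int (\<lambda>z. ennreal \<bar>\<phi> z\<bar>) y c
      \<le> ring_int (\<lambda>z. ennreal \<bar>U z\<bar> + (ennreal \<eta> + ennreal k * e z)) y c"
  proof (rule ring_int_mono)
    fix v
    have "\<bar>\<phi> z\<bar> \<le> \<bar>U z\<bar> + (\<eta> + k * a z)" for z using dU[of z] by linarith
    then show "ennreal \<bar>\<phi> (y + c *\<^sub>R v)\<bar> \<le> ennreal \<bar>U (y + c *\<^sub>R v)\<bar> + (ennreal \<eta> + ennreal k * e (y + c *\<^sub>R v))"
      using \<eta> k a by (simp add: e ennreal_leI flip: ennreal_plus ennreal_mult)
  qed
  then have ring: "ring_int (\<lambda>z. ennreal \<bar>\<phi> z\<bar>) y c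
      \<le> ring_int (\<lambda>z. ennreal \<bar>U z\<bar>) y c + (ennreal (\<eta> * \<sigma>) + ennreal k * ring_int e y c)"
    using \<eta> \<sigma> by (simp add: ring_int_add ring_int_cmult ring_int_const ennreal_mult flip: \<sigma>_def)
  have "cone_int (\<lambda>z. ennreal (c * norm (gradient \<phi> z))) y c
      \<le> cone_int (\<lambda>z. ennreal (c * G z) + (ennreal (c * \<eta>) + ennreal (c * k) * e z)) y c"
  proof (rule cone_int_mono)
    fix w
    have "c * norm (gradient \<phi> z) \<le> c * (G z + (\<eta> + k * a z))" for z
      using dG[of z] c by (intro mult_left_mono) linarith+
    then show "ennreal (c * norm (gradient \<phi> (y + w))) \<le> ennreal (c * G (y + w)) + (ennreal (c * \<eta>) + ennreal (c * k) * e (y + w))"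
      using \<eta> k a c G by (simp add: e ennreal_leI distrib_left mult.assoc flip: ennreal_plus ennreal_mult)
  qed
  then have cone: "cone_int (\<lambda>z. ennreal (c * norm (gradient \<phi> z))) y c
      \<le> cone_int (\<lambda>z. ennreal (c * G z)) y c + (ennreal (c * \<eta> * \<sigma>) + ennreal (c * k) * cone_int e y c)"
    using \<eta> \<sigma> c by (simp add: cone_int_add cone_int_cmult cone_int_const ennreal_mult flip: \<sigma>_def)
  have "e y + ring_int e y c + cone_int e y c < \<infinity>" by (rule order_le_less_trans[OF E]) simp
  then obtain p q where p: "0 \<le> p" "ring_int e y c = ennreal p" and q: "0 \<le> q" "cone_int e y c = ennreal q"
    by (cases "ring_int e y c"; cases "cone_int e y c") auto
  have "ennreal (a y + p + q) \<le> ennreal (\<eta> ^ N)" using E a p q by (simp add: e)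
  then have apq: "a y + p + q \<le> \<eta> ^ N" using \<eta> by (subst (asm) ennreal_le_iff) auto
  have "\<eta> ^ N = \<eta> * \<eta> ^ (N - 1)" using N by (simp add: power_eq_if)
  then have "k * \<eta> ^ N = \<eta>" using \<eta> by (simp add: k_def)
  then have kE: "k * (a y + p + q) \<le> \<eta>" using mult_left_mono[OF apq k] by simp
  moreover have "0 \<le> k * a y" "0 \<le> k * p" "0 \<le> k * q" using k a p q by auto
  ultimately have kk: "k * a y \<le> \<eta>" "k * p \<le> \<eta>" "k * q \<le> \<eta>" by (auto simp: distrib_left)
  have "\<sigma> * \<bar>U y\<bar> \<le> \<sigma> * (\<bar>\<phi> y\<bar> + (\<eta> + k * a y))"
    using dU[of y] \<sigma> by (intro mult_left_mono) linarith+
  then have "ennreal (\<sigma> * \<bar>U y\<bar>) \<le> ennreal (\<sigma> * \<bar>\<phi> y\<bar>) + ennreal (\<sigma> * (\<eta> + k * a y))"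
    using \<sigma> \<eta> k a by (simp add: ennreal_leI distrib_left flip: ennreal_plus)
  also have "ennreal (\<sigma> * \<bar>\<phi> y\<bar>) \<le> (ring_int (\<lambda>z. ennreal \<bar>U z\<bar>) y c + (ennreal (\<eta> * \<sigma>) + ennreal k * ring_int e y c))
    + (cone_int (\<lambda>z. ennreal (c * G z)) y c + (ennreal (c * \<eta> * \<sigma>) + ennreal (c * k) * cone_int e y c))"
    using potential_bound[of \<phi>, OF test_function_C1(1,3,2)[OF \<phi>] c] ring cone
    unfolding \<sigma>_def by (meson add_mono order_trans)
  finally have "ennreal (\<sigma> * \<bar>U y\<bar>) \<le> ring_int (\<lambda>z. ennreal \<bar>U z\<bar>) y c + cone_int (\<lambda>z. ennreal (c * G z)) y c
     + ennreal (\<eta> * \<sigma> + k * p + (c * \<eta> * \<sigma> + c * k * q) + \<sigma> * (\<eta> + k * a y))"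
    using \<eta> \<sigma> c k a p q by (simp add: ac_simps add_right_mono flip: ennreal_mult)
  also have "\<dots> \<le> ring_int (\<lambda>z. ennreal \<bar>U z\<bar>) y c + cone_int (\<lambda>z. ennreal (c * G z)) y c
     + ennreal ((3 * \<sigma> + \<sigma> * c + 1 + c) * \<eta>)"
  proof (intro add_left_mono ennreal_leI)
    have "c * (k * q) \<le> c * \<eta>" "\<sigma> * (k * a y) \<le> \<sigma> * \<eta>"
      using kk c \<sigma> by (auto intro!: mult_left_mono)
    then show "\<eta> * \<sigma> + k * p + (c * \<eta> * \<sigma> + c * k * q) + \<sigma> * (\<eta> + k * a y)
      \<le> (3 * \<sigma> + \<sigma> * c + 1 + c) * \<eta>"
      using kk by (simp add: algebra_simps)
  qed
  finally show ?thesis .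
qed

text \<open>
  The averages of the errors tend to zero in the mean by the Tonelli estimates, so by Fatou's lemma
  almost every point admits indices with arbitrarily small error; no subsequence has to be chosen.
  The function \<open>G\<close> stands for the norm of the weak gradient, which is all that the potential
  involves.
\<close>

lemma AE_potential_bound:
  fixes \<Omega> :: "(real ^ 'n::finite) set" and U G :: "real ^ 'n \<Rightarrow> real"
  assumes \<Omega>: "open \<Omega>" "frontier \<Omega> \<noteq> {}"
    and [measurable]: "U \<in> borel_measurable borel" "G \<in> borel_measurable borel"
    and G: "\<And>z. 0 \<le> G z" and \<phi>: "\<And>n::nat. \<phi> n \<in> test_functions \<Omega>"
    and lim: "(\<lambda>n. \<integral>\<^sup>+z. ennreal (\<bar>U z - \<phi> n z\<bar> ^ CARD('n) + \<bar>norm (gradient (\<phi> n) z) - G z\<bar> ^ CARD('n))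
      * indicator \<Omega> z \<partial>lborel) \<longlonglongrightarrow> 0"
  shows "AE y in lborel. y \<in> \<Omega> \<longrightarrow> ennreal (annulus_vol TYPE(real ^ 'n) * \<bar>U y\<bar>)
    \<le> ring_int (\<lambda>z. ennreal \<bar>U z\<bar>) y (half_bdist \<Omega> y)
      + cone_int (\<lambda>z. ennreal (half_bdist \<Omega> y * G z)) y (half_bdist \<Omega> y)"
proof -
  let ?r = "half_bdist \<Omega>" and ?\<sigma> = "annulus_vol TYPE(real ^ 'n)"
  define e where "e n z = ennreal (\<bar>U z - \<phi> n z\<bar> ^ CARD('n) + \<bar>norm (gradient (\<phi> n) z) - G z\<bar> ^ CARD('n))" for n z
  define E where "E n y = e n y + ring_int (e n) y (?r y) + cone_int (e n) y (?r y)" for n y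
  have [measurable]: "\<phi> n \<in> borel_measurable borel" "gradient (\<phi> n) \<in> borel_measurable borel" for n
    using test_function_C1[OF \<phi>] by (auto intro: borel_measurable_continuous_onI)
  have [measurable]: "\<Omega> \<in> sets borel" using \<Omega> by simp
  have [measurable]: "e n \<in> borel_measurable borel" for n unfolding e_def [abs_def] by measurable
  have [measurable]: "E n \<in> borel_measurable borel" for n unfolding E_def [abs_def] by measurable
  let ?K = "1 + 2 * ennreal (Tonelli_const TYPE(real ^ 'n))"
  have le: "(\<integral>\<^sup>+y. E n y * indicator \<Omega> y \<partial>lborel) \<le> ?K * (\<integral>\<^sup>+z. e n z * indicator \<Omega> z \<partial>lborel)" for n
  proof -
    have "(\<integral>\<^sup>+y. E n y * indicator \<Omega> y \<partial>lborel) = (\<integral>\<^sup>+z. e n z * indicator \<Omega> z \<partial>lborel)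
      + (\<integral>\<^sup>+y. ring_int (e n) y (1 * ?r y) * indicator \<Omega> y \<partial>lborel)
      + (\<integral>\<^sup>+y. cone_int (e n) y (?r y) * indicator \<Omega> y \<partial>lborel)"
      by (simp add: E_def distrib_right nn_integral_add)
    also have "\<dots> \<le> (\<integral>\<^sup>+z. e n z * indicator \<Omega> z \<partial>lborel)
        + ennreal (Tonelli_const TYPE(real ^ 'n)) * (\<integral>\<^sup>+z. e n z * indicator \<Omega> z \<partial>lborel)
        + ennreal (Tonelli_const TYPE(real ^ 'n)) * (\<integral>\<^sup>+z. e n z * indicator \<Omega> z \<partial>lborel)"
      by (intro add_mono order_refl integral_ring_int_le integral_cone_int_le \<Omega>) auto
    also have "\<dots> = ?K * (\<integral>\<^sup>+z. e n z * indicator \<Omega> z \<partial>lborel)"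
      by (simp only: distrib_right mult_2 mult_1 add.assoc)
    finally show ?thesis .
  qed
  have "(\<lambda>n. ?K * (\<integral>\<^sup>+z. e n z * indicator \<Omega> z \<partial>lborel)) \<longlonglongrightarrow> ?K * 0"
    using lim unfolding e_def [symmetric]
    by (rule tendsto_mult_ennreal[OF tendsto_const]) (simp add: ennreal_mult_eq_top_iff)
  then have "(\<lambda>n. ?K * (\<integral>\<^sup>+z. e n z * indicator \<Omega> z \<partial>lborel)) \<longlonglongrightarrow> 0" by simp
  then have "(\<lambda>n. \<integral>\<^sup>+y. E n y * indicator \<Omega> y \<partial>lborel) \<longlonglongrightarrow> 0"
    by (rule tendsto_sandwich[OF _ _ tendsto_const[of 0], rotated -1])
      (simp, intro always_eventually allI le)
  then have "liminf (\<lambda>n. \<integral>\<^sup>+y. E n y * indicator \<Omega> y \<partial>lborel) = 0"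
    by (simp add: lim_imp_Liminf)
  moreover have "(\<integral>\<^sup>+y. liminf (\<lambda>n. E n y * indicator \<Omega> y) \<partial>lborel)
      \<le> liminf (\<lambda>n. \<integral>\<^sup>+y. E n y * indicator \<Omega> y \<partial>lborel)"
    by (rule nn_integral_liminf) measurable
  ultimately have "(\<integral>\<^sup>+y. liminf (\<lambda>n. E n y * indicator \<Omega> y) \<partial>lborel) = 0" by simp
  then have "AE y in lborel. liminf (\<lambda>n. E n y * indicator \<Omega> y) = 0"
    by (subst (asm) nn_integral_0_iff_AE) auto
  then show ?thesis
  proof eventually_elim
    case (elim y)
    show ?case
    proof
      assume y: "y \<in> \<Omega>"
      have r: "0 < ?r y" using half_bdist_pos[OF \<Omega> y] .
      let ?C = "3 * ?\<sigma> + ?\<sigma> * ?r y + 1 + ?r y"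
      have C: "0 < ?C" using r annulus_vol_pos[where 'a="real ^ 'n"] by (simp add: add_pos_pos)
      show "ennreal (?\<sigma> * \<bar>U y\<bar>) \<le> ring_int (\<lambda>z. ennreal \<bar>U z\<bar>) y (?r y)
        + cone_int (\<lambda>z. ennreal (?r y * G z)) y (?r y)"
      proof (rule ennreal_le_epsilon)
        fix \<epsilon> :: real assume \<epsilon>: "0 < \<epsilon>"
        define \<eta> where "\<eta> = \<epsilon> / ?C"
        have \<eta>: "0 < \<eta>" using \<epsilon> C by (simp add: \<eta>_def)
        have "\<exists>n. E n y \<le> ennreal (\<eta> ^ CARD('n))"
        proof (rule ccontr)
          assume "\<not> ?thesis"
          then have "ennreal (\<eta> ^ CARD('n)) \<le> liminf (\<lambda>n. E n y * indicator \<Omega> y)"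
            using y by (intro Liminf_bounded) (auto simp: not_le less_imp_le)
          then show False using elim \<eta> by simp
        qed
        then obtain n where n: "E n y \<le> ennreal (\<eta> ^ CARD('n))" by blast
        have "?C * \<eta> = \<epsilon>" using C by (simp add: \<eta>_def)
        then show "ennreal (?\<sigma> * \<bar>U y\<bar>) \<le> ring_int (\<lambda>z. ennreal \<bar>U z\<bar>) y (?r y)
          + cone_int (\<lambda>z. ennreal (?r y * G z)) y (?r y) + ennreal \<epsilon>"
          using potential_bound_perturbed[where \<phi> = "\<phi> n" and c = "?r y" and y = y, OF assms(3,4) G \<phi> _ \<eta>] r n
          unfolding E_def e_def by simp
      qed
    qed
  qed
qed

section \<open>Logarithmic growth of the potential and the exponential series\<close>

lemma sum_exp_terms_le:
  fixes z :: real
  assumes "0 \<le> z" "finite F" "F \<subseteq> {m..}"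
  shows "(\<Sum>k\<in>F. z ^ k / fact k) \<le> z ^ m * exp z"
proof -
  have "z ^ k / fact k \<le> z ^ m * (z ^ (k - m) / fact (k - m))" if "k \<in> F" for k
  proof -
    have k: "m \<le> k" using that assms by auto
    have "z ^ k / fact k \<le> z ^ k / fact (k - m)"
      using assms by (intro divide_left_mono fact_mono) auto
    also have "\<dots> = z ^ m * (z ^ (k - m) / fact (k - m))" using k by (simp flip: power_add)
    finally show ?thesis .
  qed
  then have "(\<Sum>k\<in>F. z ^ k / fact k) \<le> (\<Sum>k\<in>F. z ^ m * (z ^ (k - m) / fact (k - m)))"
    by (intro sum_mono)
  also have "\<dots> = z ^ m * (\<Sum>k\<in>F. z ^ (k - m) / fact (k - m))" by (simp add: sum_distrib_left)
  also have "(\<Sum>k\<in>F. z ^ (k - m) / fact (k - m)) = (\<Sum>j\<in>(\<lambda>k. k - m) ` F. z ^ j / fact j)"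
    using assms(3) by (subst sum.reindex) (auto intro: inj_on_diff_nat)
  also have "\<dots> \<le> (\<Sum>j. z ^ j / fact j)"
    using assms summable_exp[of z] by (intro sum_le_suminf) (auto simp: field_simps)
  also have "\<dots> = exp z" by (simp add: exp_def field_simps)
  finally show ?thesis using assms by (simp add: mult_left_mono)
qed

text \<open>
  With $z = |s|^{N'}$ the function is the exponential series in \<open>z\<close> from degree $N-1$ on, and
  $z^{N-1} = |s|^N$. The first bound is sharp near the origin, the second is used away from it.
\<close>

lemma Phi_le:
  assumes N: "2 \<le> N"
  shows "Phi N s \<le> \<bar>s\<bar> ^ N * exp (\<bar>s\<bar> powr (real N / (real N - 1)))" (is ?A)
    and "Phi N s \<le> exp (\<bar>s\<bar> powr (real N / (real N - 1)))" (is ?B)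
proof -
  define z where "z = \<bar>s\<bar> powr (real N / (real N - 1))"
  have z: "0 \<le> z" by (simp add: z_def)
  have term_eq: "\<bar>s\<bar> powr (real k * (real N / (real N - 1))) = z ^ k" if "N - 1 \<le> k" for k
  proof (cases "s = 0")
    case True
    then show ?thesis using that N by (auto simp: z_def)
  next
    case False
    then show ?thesis unfolding z_def by (simp add: powr_powr powr_realpow [symmetric] mult.commute)
  qed
  have Phi: "Phi N s = (\<Sum>\<^sub>\<infinity>k\<in>{N - 1..}. z ^ k / fact k)"
    unfolding Phi_def by (intro infsum_cong) (use term_eq in auto)
  have bound: "Phi N s \<le> b"
    if "0 \<le> b" "\<And>F. finite F \<Longrightarrow> F \<subseteq> {N - 1..} \<Longrightarrow> (\<Sum>k\<in>F. z ^ k / fact k) \<le> b" for b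
  proof (cases "(\<lambda>k. z ^ k / fact k) summable_on {N - 1..}")
    case True
    then show ?thesis unfolding Phi by (rule infsum_le_finite_sums) (use that in auto)
  qed (simp add: Phi infsum_not_exists that)
  have "z ^ (N - 1) = \<bar>s\<bar> ^ N"
  proof (cases "s = 0")
    case False
    then have "z ^ (N - 1) = \<bar>s\<bar> powr (real N / (real N - 1) * real (N - 1))"
      unfolding z_def by (simp add: powr_powr powr_realpow [symmetric])
    also have "real N / (real N - 1) * real (N - 1) = real N" using N by (simp add: of_nat_diff)
    finally show ?thesis using False by (simp add: powr_realpow)
  next
    case True
    then have "z = 0" by (simp add: z_def)
    then show ?thesis using True N by (simp add: zero_power)
  qed
  moreover have "Phi N s \<le> z ^ (N - 1) * exp z"
    using z by (intro bound sum_exp_terms_le) auto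
  ultimately show ?A by (simp add: z_def)
  have "Phi N s \<le> z ^ 0 * exp z"
    using z by (intro bound sum_exp_terms_le) auto
  then show ?B by (simp add: z_def)
qed

lemma Phi_nonneg: "0 \<le> Phi N s"
  unfolding Phi_def by (intro infsum_nonneg) auto

text \<open>
  For $|u| \le 1$ the factor $|u|^N$ in the first bound for \<open>Phi\<close> gives \<open>d\<close>. For $|u| > 1$ the
  exponential gives $1 + d$, which is comparable to \<open>d\<close> because \<open>small\<close> then bounds \<open>d\<close> from below.
\<close>

lemma Phi_bound_of_log_growth:
  fixes u d A B c :: real
  assumes N: "2 \<le> N" and d: "0 \<le> d" and A: "0 \<le> A" and B: "0 < B" and c: "1 \<le> c" "B \<le> c"
    and small: "\<bar>u\<bar> ^ N \<le> A * d"
    and large: "\<bar>u\<bar> \<le> B * (1 + ln (1 + d)) powr (1 - 1 / real N)"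
  shows "Phi N (u / c) \<le> exp 1 * (A + 1) * d"
proof -
  let ?p = "real N / (real N - 1)"
  have p: "0 < ?p" using N by simp
  have le: "\<bar>u / c\<bar> \<le> \<bar>u\<bar>" 
    using c mult_left_mono[of 1 c "\<bar>u\<bar>"] by (simp add: abs_divide divide_le_eq)
  show ?thesis
  proof (cases "\<bar>u\<bar> \<le> 1")
    case True
    have "\<bar>u / c\<bar> powr ?p \<le> 1 powr ?p" using le True p by (intro powr_mono2) auto
    then have "\<bar>u / c\<bar> ^ N * exp (\<bar>u / c\<bar> powr ?p) \<le> \<bar>u\<bar> ^ N * exp 1"
      using le by (intro mult_mono power_mono) auto
    also have "\<dots> \<le> A * d * exp 1" using small by simp
    also have "\<dots> \<le> exp 1 * (A + 1) * d" using d by (simp add: algebra_simps)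
    finally show ?thesis using Phi_le(1)[OF N, of "u / c"] by linarith
  next
    case False
    then have "1 \<le> A * d" using small one_le_power[of "\<bar>u\<bar>" N] by linarith
    let ?L = "1 + ln (1 + d)"
    have L: "0 \<le> ?L" using d by simp
    have "\<bar>u / c\<bar> \<le> \<bar>u\<bar> / B" using B c by (simp add: abs_divide frac_le)
    also have "\<dots> \<le> ?L powr (1 - 1 / real N)" using large B by (simp add: field_simps)
    finally have "\<bar>u / c\<bar> powr ?p \<le> (?L powr (1 - 1 / real N)) powr ?p"
      using p by (intro powr_mono2) auto
    also have "\<dots> = ?L powr ((1 - 1 / real N) * ?p)" by (simp add: powr_powr)
    also have "(1 - 1 / real N) * ?p = 1" using N by (simp add: field_simps)
    finally have "\<bar>u / c\<bar> powr ?p \<le> ?L" using L d by simp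
    then have "exp (\<bar>u / c\<bar> powr ?p) \<le> exp ?L" by simp
    also have "exp ?L = exp 1 * (1 + d)" using d by (simp add: exp_add)
    also have "\<dots> \<le> exp 1 * ((A + 1) * d)" using \<open>1 \<le> A * d\<close> by (intro mult_left_mono) (auto simp: algebra_simps)
    finally show ?thesis using Phi_le(2)[OF N, of "u / c"] by (simp add: mult.assoc)
  qed
qed

text \<open>
  The source of the exponential integrability. Near the vertex of the cone, for $t < \tau$, the
  unweighted energy \<open>a\<close> is used; for $t > \tau$ the weighted energy is used, and the integral of $1/t$
  over $(\tau, 1)$ is a logarithm. The choice $\tau = \exp (-L)$ with $L = 1 + \log (1 + a)$ makes the first
  contribution bounded, and balancing the two parts of the second gives the power $1 - 1/N$ of \<open>L\<close>.
\<close>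

lemma cone_int_log_bound:
  fixes f :: "'a::euclidean_space \<Rightarrow> real"
  assumes [measurable]: "f \<in> borel_measurable borel" and f: "\<And>z. 0 \<le> f z"
    and N: "2 \<le> N" and a: "0 \<le> a"
    and energy: "cone_int (\<lambda>z. ennreal (f z ^ N)) y c \<le> ennreal a"
    and log_energy: "(\<integral>\<^sup>+t. ennreal (t ^ (N - 1)) * ring_int (\<lambda>z. ennreal (f z ^ N)) y (t * c)
      * indicator {0<..<1} t \<partial>lborel) \<le> 1"
  shows "cone_int (\<lambda>z. ennreal (f z)) y c
    \<le> ennreal (2 * (annulus_vol TYPE('a) + 1) * (1 + ln (1 + a)) powr (1 - 1 / real N))"
proof -
  define \<sigma> where "\<sigma> = annulus_vol TYPE('a)"
  have \<sigma>: "0 < \<sigma>" unfolding \<sigma>_def by (rule annulus_vol_pos)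
  define L where "L = 1 + ln (1 + a)"
  define \<tau> where "\<tau> = exp (- L)"
  \<comment> \<open>The threshold for \<open>x\<close> at height \<open>t\<close> is \<open>\<mu> / t\<close>; this \<open>\<mu>\<close> makes \<open>\<mu> * L\<close> and \<open>1 / \<mu> ^ (N - 1)\<close> equal.\<close>
  define \<mu> where "\<mu> = L powr (- 1 / real N)"
  define P where "P = L powr (1 - 1 / real N)"
  have L: "1 \<le> L" using a by (simp add: L_def)
  have \<mu>: "0 < \<mu>" using L by (simp add: \<mu>_def)
  have \<tau>: "0 < \<tau>" "\<tau> < 1" using L by (auto simp: \<tau>_def)
  have P: "1 \<le> P" using L N by (auto simp: P_def intro!: ge_one_powr_ge_zero)
  have \<mu>L: "\<mu> * L = P"
  proof -
    have "\<mu> * L = L powr (- 1 / real N) * L powr 1" using L by (simp add: \<mu>_def)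
    also have "\<dots> = P" unfolding P_def powr_add [symmetric] by simp
    finally show ?thesis .
  qed
  have \<mu>P: "1 / \<mu> ^ (N - 1) = P"
  proof -
    have "\<mu> ^ (N - 1) = L powr (- 1 / real N * real (N - 1))"
      using \<mu> by (simp add: powr_realpow [symmetric] powr_powr \<mu>_def)
    also have "- 1 / real N * real (N - 1) = - (1 - 1 / real N)"
      using N by (simp add: of_nat_diff field_simps)
    also have "L powr - (1 - 1 / real N) = inverse P" unfolding P_def by (rule powr_minus)
    finally show ?thesis by (simp add: inverse_eq_divide)
  qed
  have \<tau>a: "\<tau> ^ (N - 1) * a \<le> 1"
  proof -
    have "\<tau> ^ (N - 1) \<le> \<tau> ^ 1" using \<tau> N by (intro power_decreasing) auto
    then have "\<tau> ^ (N - 1) * a \<le> \<tau> * a" using a by (simp add: mult_right_mono)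
    also have "\<dots> \<le> \<tau> * exp L"
    proof (intro mult_left_mono)
      have "a \<le> exp (ln (1 + a))" using a by simp
      also have "\<dots> \<le> exp L" by (simp add: L_def)
      finally show "a \<le> exp L" .
    qed (use \<tau> in simp)
    also have "\<dots> = 1" by (simp add: \<tau>_def flip: exp_add)
    finally show ?thesis .
  qed
  let ?R = "\<lambda>t. ring_int (\<lambda>z. ennreal (f z ^ N)) y (t * c)"
  let ?w = "\<lambda>t. ennreal (1 / \<tau>) * indicator {0<..<\<tau>} t + ennreal (\<mu> / t) * indicator {\<tau>..1} t"
  let ?k = "\<lambda>t. ennreal (\<tau> ^ (N - 1)) + ennreal P * ennreal (t ^ (N - 1))"
  have pt: "ennreal x \<le> ?w t + ?k t * ennreal (x ^ N)" if t: "0 < t" "t < 1" and x: "0 \<le> x" for t x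
  proof (cases "t < \<tau>")
    case True
    have "x \<le> 1 / \<tau> + \<tau> ^ (N - 1) * x ^ N"
      using le_add_power_over[of x "1 / \<tau>" N] x \<tau> N by (simp add: power_divide mult.commute)
    then have "ennreal x \<le> ennreal (1 / \<tau>) + ennreal (\<tau> ^ (N - 1)) * ennreal (x ^ N)"
      using x \<tau> by (simp add: ennreal_leI flip: ennreal_plus ennreal_mult)
    also have "\<dots> \<le> ?w t + ?k t * ennreal (x ^ N)"
      using True t by (intro add_mono mult_right_mono) auto
    finally show ?thesis .
  next
    case False
    have "x \<le> \<mu> / t + (1 / \<mu> ^ (N - 1)) * t ^ (N - 1) * x ^ N"
      using le_add_power_over[of x "\<mu> / t" N] x t \<mu> N by (simp add: power_divide mult.commute)
    then have "x \<le> \<mu> / t + P * t ^ (N - 1) * x ^ N" unfolding \<mu>P .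
    then have "ennreal x \<le> ennreal (\<mu> / t) + ennreal P * ennreal (t ^ (N - 1)) * ennreal (x ^ N)"
      using x t P \<mu> by (simp add: ennreal_leI flip: ennreal_plus ennreal_mult)
    also have "\<dots> \<le> ?w t + ?k t * ennreal (x ^ N)"
      using False t by (intro add_mono mult_right_mono) auto
    finally show ?thesis .
  qed
  have ring: "ring_int (\<lambda>z. ennreal (f z)) y (t * c) * indicator {0<..<1} t
      \<le> ?w t * ennreal \<sigma> + (ennreal (\<tau> ^ (N - 1)) * (?R t * indicator {0<..<1} t)
        + ennreal P * (ennreal (t ^ (N - 1)) * ?R t * indicator {0<..<1} t))" for t
  proof (cases "t \<in> {0<..<1}")
    case True
    have "ring_int (\<lambda>z. ennreal (f z)) y (t * c) \<le> ring_int (\<lambda>z. ?w t + ?k t * ennreal (f z ^ N)) y (t * c)"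
      using True f by (intro ring_int_mono pt) auto
    also have "\<dots> = ?w t * ennreal \<sigma> + ?k t * ?R t"
      by (simp add: ring_int_add ring_int_cmult ring_int_const \<sigma>_def)
    finally show ?thesis using True by (simp add: distrib_right mult.assoc)
  qed simp
  have w: "(\<integral>\<^sup>+t. ?w t \<partial>lborel) = ennreal (1 + P)"
  proof -
    have "(\<integral>\<^sup>+t. ennreal (1 / \<tau>) * indicator {0<..<\<tau>} t \<partial>lborel) = ennreal (1 / \<tau>) * ennreal \<tau>"
      using \<tau> by (subst nn_integral_cmult_indicator) simp_all
    also have "\<dots> = ennreal (1 / \<tau> * \<tau>)" using \<tau> by (intro ennreal_mult [symmetric]) auto
    finally have w1: "(\<integral>\<^sup>+t. ennreal (1 / \<tau>) * indicator {0<..<\<tau>} t \<partial>lborel) = 1"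
      using \<tau> by simp
    have "(\<integral>\<^sup>+t. ennreal (\<mu> / t) * indicator {\<tau>..1} t \<partial>lborel) = ennreal (\<mu> * ln 1 - \<mu> * ln \<tau>)"
    proof (rule nn_integral_FTC_Icc)
      fix t assume "t \<in> {\<tau>..1}"
      then have "0 < t" using \<tau> by auto
      then show "((\<lambda>t. \<mu> * ln t) has_real_derivative \<mu> / t) (at t)"
        by (auto intro!: derivative_eq_intros)
      show "0 \<le> \<mu> / t" using \<open>0 < t\<close> \<mu> by simp
    qed (use \<tau> in auto)
    also have "\<mu> * ln 1 - \<mu> * ln \<tau> = P" using \<mu>L by (simp add: \<tau>_def)
    finally show ?thesis using w1 P by (simp add: nn_integral_add)
  qed
  have "cone_int (\<lambda>z. ennreal (f z)) y c
      \<le> (\<integral>\<^sup>+t. ?w t * ennreal \<sigma> + (ennreal (\<tau> ^ (N - 1)) * (?R t * indicator {0<..<1} t)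
        + ennreal P * (ennreal (t ^ (N - 1)) * ?R t * indicator {0<..<1} t)) \<partial>lborel)"
    unfolding cone_int_def by (intro nn_integral_mono ring)
  also have "\<dots> = (\<integral>\<^sup>+t. ?w t \<partial>lborel) * ennreal \<sigma>
      + (ennreal (\<tau> ^ (N - 1)) * cone_int (\<lambda>z. ennreal (f z ^ N)) y c
        + ennreal P * (\<integral>\<^sup>+t. ennreal (t ^ (N - 1)) * ?R t * indicator {0<..<1} t \<partial>lborel))"
    unfolding cone_int_def
    by (simp add: nn_integral_add nn_integral_cmult nn_integral_multc)
  also have "\<dots> \<le> ennreal (1 + P) * ennreal \<sigma> + (ennreal (\<tau> ^ (N - 1)) * ennreal a + ennreal P * 1)"
    unfolding w by (intro add_mono mult_left_mono energy log_energy) auto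
  also have "\<dots> = ennreal ((1 + P) * \<sigma> + (\<tau> ^ (N - 1) * a + P))"
    using \<tau> a P \<sigma> by (simp flip: ennreal_plus ennreal_mult)
  also have "\<dots> \<le> ennreal (2 * (\<sigma> + 1) * P)"
  proof (rule ennreal_leI)
    have "(1 + P) * \<sigma> \<le> (2 * P) * \<sigma>" using P \<sigma> by (intro mult_right_mono) auto
    then show "(1 + P) * \<sigma> + (\<tau> ^ (N - 1) * a + P) \<le> 2 * (\<sigma> + 1) * P"
      using \<tau>a P by (simp add: algebra_simps)
  qed
  finally show ?thesis by (simp add: \<sigma>_def P_def L_def)
qed

section \<open>Pointwise bounds by the local energy\<close>

text \<open>
  Here \<open>c\<close> is the scale at \<open>y\<close> and \<open>H\<close> the energy density $|\nabla u|^N + |u|^N/\delta^N$; the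
  factor \<open>3 * c\<close> bounds \<open>\<delta>\<close> on the ball of radius \<open>c\<close>. The first bound takes the free
  threshold proportional to $|U(y)|$ and absorbs the linear term. The second uses the bound on the
  total energy in the ball, through \<open>cone_int_log_bound\<close>.
\<close>

lemma local_energy_bounds:
  fixes \<Omega> :: "'a::euclidean_space set" and U G H :: "'a \<Rightarrow> real"
  defines "N \<equiv> DIM('a)" and "\<sigma> \<equiv> annulus_vol TYPE('a)"
  assumes N: "2 \<le> N"
    and [measurable]: "U \<in> borel_measurable borel" "G \<in> borel_measurable borel" "H \<in> borel_measurable borel"
    and G: "\<And>z. 0 \<le> G z" and H: "\<And>z. 0 \<le> H z" and c: "0 < c"
    and U_le: "\<And>z. z \<in> cball y c \<Longrightarrow> \<bar>U z\<bar> ^ N \<le> (3 * c) ^ N * H z"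
    and G_le: "\<And>z. G z ^ N \<le> H z"
    and H_int: "(\<integral>\<^sup>+z. ennreal (H z) * indicator (cball y c) z \<partial>lborel) \<le> 1"
    and pot: "ennreal (\<sigma> * \<bar>U y\<bar>) \<le> ring_int (\<lambda>z. ennreal \<bar>U z\<bar>) y c
      + cone_int (\<lambda>z. ennreal (c * G z)) y c"
    and d: "0 \<le> d"
      "ennreal (c ^ N) * (cone_int (\<lambda>z. ennreal (H z)) y c + 3 ^ N * ring_int (\<lambda>z. ennreal (H z)) y c) \<le> ennreal d"
  shows "\<bar>U y\<bar> ^ N \<le> (2 * 4 ^ (N - 1) / \<sigma>) * d"
    and "\<bar>U y\<bar> \<le> ((3 * \<sigma> + 2 + 3 ^ N) / \<sigma>) * (1 + ln (1 + d)) powr (1 - 1 / real N)"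
proof -
  have \<sigma>: "0 < \<sigma>" unfolding \<sigma>_def by (rule annulus_vol_pos)
  let ?rU = "ring_int (\<lambda>z. ennreal (\<bar>U z\<bar> ^ N)) y c"
  let ?cG = "cone_int (\<lambda>z. ennreal ((c * G z) ^ N)) y c"
  let ?rH = "ring_int (\<lambda>z. ennreal (H z)) y c" and ?cH = "cone_int (\<lambda>z. ennreal (H z)) y c"
  have "?rU \<le> ring_int (\<lambda>z. ennreal (c ^ N * 3 ^ N) * ennreal (H z)) y c"
  proof (rule ring_int_mono)
    fix v :: 'a assume "v \<in> annulus"
    then have "y + c *\<^sub>R v \<in> cball y c" using c by (simp add: annulus_def dist_norm mult_left_le)
    from U_le[OF this] show "ennreal (\<bar>U (y + c *\<^sub>R v)\<bar> ^ N) \<le> ennreal (c ^ N * 3 ^ N) * ennreal (H (y + c *\<^sub>R v))"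
      using H c by (simp add: ennreal_leI power_mult_distrib mult_ac flip: ennreal_mult)
  qed
  then have rU: "?rU \<le> ennreal (c ^ N * 3 ^ N) * ?rH" by (simp add: ring_int_cmult)
  have "?cG \<le> cone_int (\<lambda>z. ennreal (c ^ N) * ennreal (H z)) y c"
    using c G G_le H by (intro cone_int_mono)
      (simp add: power_mult_distrib ennreal_leI mult_left_mono flip: ennreal_mult)
  then have cG: "?cG \<le> ennreal (c ^ N) * ?cH" by (simp add: cone_int_cmult)
  have d_eq: "ennreal (c ^ N) * (?cH + 3 ^ N * ?rH) = ennreal (c ^ N) * ?cH + ennreal (c ^ N * 3 ^ N) * ?rH"
    using c by (simp add: distrib_left ennreal_mult ennreal_power [symmetric] mult.assoc)
  have sum_le: "?rU + ?cG \<le> ennreal d"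
    using order_trans[OF add_mono[OF rU cG]] d(2) unfolding d_eq by (simp add: add.commute)
  show "\<bar>U y\<bar> ^ N \<le> (2 * 4 ^ (N - 1) / \<sigma>) * d"
  proof (cases "U y = 0")
    case True
    then show ?thesis using N d \<sigma> by (simp add: power_0_left)
  next
    case False
    \<comment> \<open>The two averages contribute \<open>2 * \<eta> * \<sigma>\<close>, which is half of the left-hand side.\<close>
    define \<eta> where "\<eta> = \<bar>U y\<bar> / 4"
    have \<eta>: "0 < \<eta>" using False by (simp add: \<eta>_def)
    let ?k = "1 / \<eta> ^ (N - 1)"
    have pt: "ennreal x \<le> ennreal \<eta> + ennreal ?k * ennreal (x ^ N)" if "0 \<le> x" for x
      using le_add_power_over[OF that \<eta>, of N] N \<eta> that
      by (simp add: ennreal_leI flip: ennreal_plus ennreal_mult)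
    have "ring_int (\<lambda>z. ennreal \<bar>U z\<bar>) y c \<le> ring_int (\<lambda>z. ennreal \<eta> + ennreal ?k * ennreal (\<bar>U z\<bar> ^ N)) y c"
      by (intro ring_int_mono pt) simp
    then have 1: "ring_int (\<lambda>z. ennreal \<bar>U z\<bar>) y c \<le> ennreal \<eta> * ennreal \<sigma> + ennreal ?k * ?rU"
      by (simp add: ring_int_add ring_int_cmult ring_int_const \<sigma>_def)
    have "cone_int (\<lambda>z. ennreal (c * G z)) y c \<le> cone_int (\<lambda>z. ennreal \<eta> + ennreal ?k * ennreal ((c * G z) ^ N)) y c"
      using c G by (intro cone_int_mono pt) simp
    then have 2: "cone_int (\<lambda>z. ennreal (c * G z)) y c \<le> ennreal \<eta> * ennreal \<sigma> + ennreal ?k * ?cG"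
      by (simp add: cone_int_add cone_int_cmult cone_int_const \<sigma>_def)
    have "ennreal (\<sigma> * \<bar>U y\<bar>) \<le> (ennreal \<eta> * ennreal \<sigma> + ennreal ?k * ?rU) + (ennreal \<eta> * ennreal \<sigma> + ennreal ?k * ?cG)"
      using pot add_mono[OF 1 2] by (rule order_trans)
    also have "\<dots> = (ennreal \<eta> * ennreal \<sigma> + ennreal \<eta> * ennreal \<sigma>) + ennreal ?k * (?rU + ?cG)"
      by (simp only: distrib_left ac_simps)
    also have "\<dots> \<le> (ennreal \<eta> * ennreal \<sigma> + ennreal \<eta> * ennreal \<sigma>) + ennreal ?k * ennreal d"
      by (intro add_left_mono mult_left_mono sum_le) simp
    also have "\<dots> = ennreal (2 * \<eta> * \<sigma> + ?k * d)"
      using \<eta> \<sigma> d by (simp flip: ennreal_plus ennreal_mult)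
    finally have "\<sigma> * \<bar>U y\<bar> \<le> 2 * \<eta> * \<sigma> + ?k * d"
      using \<eta> \<sigma> d by (subst (asm) ennreal_le_iff) auto
    then have "\<sigma> * \<bar>U y\<bar> / 2 \<le> d / \<eta> ^ (N - 1)" by (simp add: \<eta>_def field_simps)
    then have "\<sigma> * \<bar>U y\<bar> / 2 * \<eta> ^ (N - 1) \<le> d" using \<eta> by (simp add: pos_le_divide_eq)
    moreover have "\<bar>U y\<bar> ^ N = \<bar>U y\<bar> * \<bar>U y\<bar> ^ (N - 1)" using N by (simp add: power_eq_if)
    ultimately have "\<sigma> * \<bar>U y\<bar> ^ N \<le> 2 * 4 ^ (N - 1) * d"
      by (simp add: \<eta>_def power_divide field_simps)
    then show ?thesis using \<sigma> by (simp add: field_simps)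
  qed
  let ?P = "(1 + ln (1 + d)) powr (1 - 1 / real N)"
  have P: "1 \<le> ?P" using d N by (intro ge_one_powr_ge_zero) auto
  have rH: "ennreal (c ^ N) * ?rH \<le> 1"
    using order_trans[OF ring_int_le_integral_cball[of "\<lambda>z. ennreal (H z)" c y] H_int] c
    by (simp add: N_def)
  have "ring_int (\<lambda>z. ennreal \<bar>U z\<bar>) y c \<le> ring_int (\<lambda>z. 1 + ennreal (\<bar>U z\<bar> ^ N)) y c"
  proof (rule ring_int_mono)
    fix v
    show "ennreal \<bar>U (y + c *\<^sub>R v)\<bar> \<le> 1 + ennreal (\<bar>U (y + c *\<^sub>R v)\<bar> ^ N)"
      using le_add_power_over[of "\<bar>U (y + c *\<^sub>R v)\<bar>" 1 N] N
      by (simp add: ennreal_leI flip: ennreal_plus ennreal_1)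
  qed
  also have "\<dots> = ennreal \<sigma> + ?rU" by (simp add: ring_int_add ring_int_const \<sigma>_def)
  also have "\<dots> \<le> ennreal \<sigma> + ennreal (3 ^ N)"
  proof (intro add_left_mono)
    have "?rU \<le> ennreal (3 ^ N) * (ennreal (c ^ N) * ?rH)"
      using rU c by (simp add: ennreal_mult mult_ac)
    also have "\<dots> \<le> ennreal (3 ^ N) * 1" by (intro mult_left_mono rH) simp
    finally show "?rU \<le> ennreal (3 ^ N)" by simp
  qed
  finally have 1: "ring_int (\<lambda>z. ennreal \<bar>U z\<bar>) y c \<le> ennreal \<sigma> + ennreal (3 ^ N)" .
  have 2: "cone_int (\<lambda>z. ennreal (c * G z)) y c \<le> ennreal (2 * (\<sigma> + 1) * ?P)"
    unfolding \<sigma>_def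
  proof (rule cone_int_log_bound[OF _ _ N d(1)])
    show "?cG \<le> ennreal d" using sum_le by (rule order_trans[rotated]) simp
    have "(\<integral>\<^sup>+t. ennreal (t ^ (N - 1)) * ring_int (\<lambda>z. ennreal ((c * G z) ^ N)) y (t * c) * indicator {0<..<1} t \<partial>lborel)
        \<le> (\<integral>\<^sup>+t. ennreal (c ^ N) * (ennreal (t ^ (N - 1)) * ring_int (\<lambda>z. ennreal (H z)) y (t * c) * indicator {0<..<1} t) \<partial>lborel)"
    proof (rule nn_integral_mono)
      fix t
      have "ring_int (\<lambda>z. ennreal ((c * G z) ^ N)) y (t * c) \<le> ring_int (\<lambda>z. ennreal (c ^ N) * ennreal (H z)) y (t * c)"
        using c G G_le H by (intro ring_int_mono)
          (simp add: power_mult_distrib ennreal_leI mult_left_mono flip: ennreal_mult)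
      then have "ring_int (\<lambda>z. ennreal ((c * G z) ^ N)) y (t * c) \<le> ennreal (c ^ N) * ring_int (\<lambda>z. ennreal (H z)) y (t * c)"
        by (simp add: ring_int_cmult)
      then have "ennreal (t ^ (N - 1)) * ring_int (\<lambda>z. ennreal ((c * G z) ^ N)) y (t * c) * indicator {0<..<1} t
        \<le> ennreal (t ^ (N - 1)) * (ennreal (c ^ N) * ring_int (\<lambda>z. ennreal (H z)) y (t * c)) * indicator {0<..<1} t"
        by (intro mult_right_mono mult_left_mono) auto
      then show "ennreal (t ^ (N - 1)) * ring_int (\<lambda>z. ennreal ((c * G z) ^ N)) y (t * c) * indicator {0<..<1} t
        \<le> ennreal (c ^ N) * (ennreal (t ^ (N - 1)) * ring_int (\<lambda>z. ennreal (H z)) y (t * c) * indicator {0<..<1} t)"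
        by (simp only: mult_ac)
    qed
    also have "\<dots> = ennreal (c ^ N) * (\<integral>\<^sup>+t. ennreal (t ^ (N - 1)) * ring_int (\<lambda>z. ennreal (H z)) y (t * c) * indicator {0<..<1} t \<partial>lborel)"
      by (rule nn_integral_cmult) measurable
    also have "\<dots> \<le> 1"
      unfolding N_def using order_trans[OF weighted_cone_le_integral_cball H_int] c by simp
    finally show "(\<integral>\<^sup>+t. ennreal (t ^ (N - 1)) * ring_int (\<lambda>z. ennreal ((c * G z) ^ N)) y (t * c) * indicator {0<..<1} t \<partial>lborel) \<le> 1" .
  qed (use c G in auto)
  have "ennreal (\<sigma> * \<bar>U y\<bar>) \<le> ennreal \<sigma> + ennreal (3 ^ N) + ennreal (2 * (\<sigma> + 1) * ?P)"
    using pot add_mono[OF 1 2] by (rule order_trans)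
  also have "\<dots> = ennreal (\<sigma> + 3 ^ N + 2 * (\<sigma> + 1) * ?P)"
    using \<sigma> P by (simp flip: ennreal_plus)
  finally have "\<sigma> * \<bar>U y\<bar> \<le> \<sigma> + 3 ^ N + 2 * (\<sigma> + 1) * ?P"
    using \<sigma> P by (subst (asm) ennreal_le_iff) auto
  also have "\<dots> \<le> (\<sigma> + 3 ^ N) * ?P + 2 * (\<sigma> + 1) * ?P"
    using \<sigma> P mult_left_mono[of 1 ?P "\<sigma> + 3 ^ N"] by simp
  also have "\<dots> = (3 * \<sigma> + 2 + 3 ^ N) * ?P" by (simp add: algebra_simps)
  finally show "\<bar>U y\<bar> \<le> ((3 * \<sigma> + 2 + 3 ^ N) / \<sigma>) * ?P"
    using \<sigma> by (simp add: field_simps)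
qed

section \<open>Integration over the domain\<close>

text \<open>
  All hypotheses on \<open>U\<close> and \<open>G\<close> are measure theoretic: the Sobolev structure enters only through the
  potential bound \<open>pot\<close>. The integrals are taken with respect to the Borel measure because the
  averages compose \<open>U\<close> and \<open>G\<close> with maps of several variables, which preserves Borel but not
  Lebesgue measurability.
\<close>

lemma weighted_Phi_integral_le:
  fixes \<Omega> :: "(real ^ 'n::finite) set" and U G :: "real ^ 'n \<Rightarrow> real"
  defines "N \<equiv> CARD('n)" and "\<sigma> \<equiv> annulus_vol TYPE(real ^ 'n)"
  assumes N: "2 \<le> N" and \<Omega>: "open \<Omega>" "frontier \<Omega> \<noteq> {}"
    and [measurable]: "U \<in> borel_measurable borel" "G \<in> borel_measurable borel"
    and G: "\<And>z. 0 \<le> G z"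
    and int: "(\<integral>\<^sup>+z. ennreal (G z ^ N + \<bar>U z\<bar> ^ N / bdist \<Omega> z ^ N) * indicator \<Omega> z \<partial>lborel) \<le> 1"
    and pot: "AE y in lborel. y \<in> \<Omega> \<longrightarrow> ennreal (\<sigma> * \<bar>U y\<bar>)
      \<le> ring_int (\<lambda>z. ennreal \<bar>U z\<bar>) y (half_bdist \<Omega> y)
        + cone_int (\<lambda>z. ennreal (half_bdist \<Omega> y * G z)) y (half_bdist \<Omega> y)"
    and A: "A = 2 * 4 ^ (N - 1) / \<sigma>" and B: "B = (3 * \<sigma> + 2 + 3 ^ N) / \<sigma>" and c: "1 \<le> c" "B \<le> c"
  shows "(\<integral>\<^sup>+y. ennreal (Phi N (U y / c) / bdist \<Omega> y ^ N) * indicator \<Omega> y \<partial>lborel)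
    \<le> ennreal (exp 1 * (A + 1) * ((1 / 2) ^ N * (Tonelli_const TYPE(real ^ 'n) * (1 + 3 ^ N))))"
proof -
  let ?r = "half_bdist \<Omega>" and ?K = "Tonelli_const TYPE(real ^ 'n)"
  have [measurable]: "\<Omega> \<in> sets borel" using \<Omega> by simp
  have \<sigma>: "0 < \<sigma>" unfolding \<sigma>_def by (rule annulus_vol_pos)
  have A0: "0 \<le> A" and B0: "0 < B" using \<sigma> unfolding A B by (auto intro!: divide_pos_pos add_pos_pos)
  have bd: "bdist \<Omega> z = 2 * ?r z" for z by (simp add: bdist_def half_bdist_def)
  have r0: "0 \<le> ?r z" for z by (simp add: half_bdist_def infdist_nonneg)
  define H where "H z = G z ^ N + \<bar>U z\<bar> ^ N / (2 * ?r z) ^ N" for z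
  have H: "0 \<le> H z" for z using G r0 by (simp add: H_def)
  have [measurable]: "H \<in> borel_measurable borel" unfolding H_def [abs_def] by measurable
  have H_int: "(\<integral>\<^sup>+z. ennreal (H z) * indicator \<Omega> z \<partial>lborel) \<le> 1" using int by (simp add: H_def bd)
  let ?D = "\<lambda>y. cone_int (\<lambda>z. ennreal (H z)) y (?r y) + 3 ^ N * ring_int (\<lambda>z. ennreal (H z)) y (?r y)"
  let ?C = "exp 1 * (A + 1)"
  have C0: "0 < ?C" using A0 by simp
  have "AE y in lborel. ennreal (Phi N (U y / c) / bdist \<Omega> y ^ N) * indicator \<Omega> y
      \<le> ennreal (?C * (1 / 2) ^ N) * (?D y * indicator \<Omega> y)"
    using pot
  proof eventually_elim
    case (elim y)
    show ?case
    proof (cases "y \<in> \<Omega> \<and> ?D y < \<infinity>")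
      case False
      show ?thesis
      proof (cases "y \<in> \<Omega>")
        case True
        have "0 < ?C * (1 / 2) ^ N" using C0 by simp
        moreover have "?D y = top" using False True by (simp only: simp_thms not_less infinity_ennreal_def top_unique)
        ultimately have "ennreal (?C * (1 / 2) ^ N) * (?D y * indicator \<Omega> y) = top"
          using True by (simp only: indicator_simps mult_1_right ennreal_mult_eq_top_iff ennreal_eq_0_iff) auto
        then show ?thesis by (simp only: top_greatest)
      qed simp
    next
      case True
      then have y: "y \<in> \<Omega>" by simp
      have r: "0 < ?r y" using half_bdist_pos[OF \<Omega> y] .
      have sub: "cball y (?r y) \<subseteq> \<Omega>" using cball_half_bdist_subset[OF \<Omega> y] .
      have U_le: "\<bar>U z\<bar> ^ N \<le> (3 * ?r y) ^ N * H z" if "z \<in> cball y (?r y)" for z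
      proof -
        have rz: "0 < ?r z" using half_bdist_pos[OF \<Omega>] sub that by auto
        have "2 * ?r z \<le> 3 * ?r y" using half_bdist_Lipschitz[of \<Omega> z y] that by (simp add: dist_commute)
        then have "(2 * ?r z) ^ N * H z \<le> (3 * ?r y) ^ N * H z"
          using rz H by (intro mult_right_mono power_mono) auto
        moreover have "\<bar>U z\<bar> ^ N \<le> (2 * ?r z) ^ N * H z"
          using rz G by (simp add: H_def distrib_left)
        ultimately show ?thesis by linarith
      qed
      have Hc: "(\<integral>\<^sup>+z. ennreal (H z) * indicator (cball y (?r y)) z \<partial>lborel) \<le> 1"
        using sub by (intro order_trans[OF _ H_int] nn_integral_mono) (auto simp: indicator_def)
      obtain D where D: "0 \<le> D" "?D y = ennreal D"
        using True by (cases "?D y") auto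
      have d: "0 \<le> ?r y ^ N * D" "ennreal (?r y ^ N) * ?D y \<le> ennreal (?r y ^ N * D)"
        unfolding D(2) using D(1) r by (auto simp flip: ennreal_mult)
      note bounds = local_energy_bounds[where y = y and c = "?r y" and U = U and G = G and H = H and d = "?r y ^ N * D",
        unfolded DIM_cart DIM_real mult_1_right, folded N_def \<sigma>_def, OF N]
      have 1: "\<bar>U y\<bar> ^ N \<le> A * (?r y ^ N * D)"
        unfolding A by (rule bounds(1)) (use G H r U_le r0 Hc elim y d in \<open>auto simp: H_def\<close>)
      have 2: "\<bar>U y\<bar> \<le> B * (1 + ln (1 + ?r y ^ N * D)) powr (1 - 1 / real N)"
        unfolding B by (rule bounds(2)) (use G H r U_le r0 Hc elim y d in \<open>auto simp: H_def\<close>)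
      have "Phi N (U y / c) \<le> ?C * (?r y ^ N * D)"
        by (rule Phi_bound_of_log_growth[OF N d(1) A0 B0 c 1 2])
      then have "Phi N (U y / c) / bdist \<Omega> y ^ N \<le> ?C * (?r y ^ N * D) / (2 * ?r y) ^ N"
        unfolding bd using r by (intro divide_right_mono) auto
      also have "\<dots> = ?C * (1 / 2) ^ N * D"
        using r by (simp add: power_mult_distrib power_divide field_simps)
      finally show ?thesis using y D C0 by (simp add: ennreal_leI flip: ennreal_mult)
    qed
  qed
  then have "(\<integral>\<^sup>+y. ennreal (Phi N (U y / c) / bdist \<Omega> y ^ N) * indicator \<Omega> y \<partial>lborel)
      \<le> (\<integral>\<^sup>+y. ennreal (?C * (1 / 2) ^ N) * (?D y * indicator \<Omega> y) \<partial>lborel)"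
    by (rule nn_integral_mono_AE)
  also have "\<dots> = ennreal (?C * (1 / 2) ^ N) * ((\<integral>\<^sup>+y. cone_int (\<lambda>z. ennreal (H z)) y (?r y) * indicator \<Omega> y \<partial>lborel)
      + 3 ^ N * (\<integral>\<^sup>+y. ring_int (\<lambda>z. ennreal (H z)) y (1 * ?r y) * indicator \<Omega> y \<partial>lborel))"
    by (simp add: nn_integral_cmult nn_integral_add distrib_right mult.assoc)
  also have "\<dots> \<le> ennreal (?C * (1 / 2) ^ N) * (ennreal ?K * 1 + 3 ^ N * (ennreal ?K * 1))"
    by (intro mult_left_mono add_mono order_trans[OF integral_cone_int_le[OF \<Omega>]]
        order_trans[OF integral_ring_int_le[OF \<Omega>]] H_int) auto
  also have "\<dots> = ennreal (?C * (1 / 2) ^ N) * ennreal (?K * (1 + 3 ^ N))"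
  proof -
    have "ennreal k * 1 + 3 ^ N * (ennreal k * 1) = ennreal (k * (1 + 3 ^ N))" if "0 \<le> k" for k
      using that by (simp add: distrib_left ennreal_mult ennreal_power [symmetric] mult.commute)
    then show ?thesis by simp
  qed
  also have "\<dots> = ennreal ((?C * (1 / 2) ^ N) * (?K * (1 + 3 ^ N)))"
    using C0 by (intro ennreal_mult [symmetric]) auto
  also have "(?C * (1 / 2) ^ N) * (?K * (1 + 3 ^ N)) = ?C * ((1 / 2) ^ N * (?K * (1 + 3 ^ N)))"
    by (rule mult.assoc)
  finally show ?thesis .
qed

section \<open>The inequality on the Sobolev space\<close>

lemma borel_representative:
  fixes f :: "'a::euclidean_space \<Rightarrow> real"
  assumes "\<Omega> \<in> sets borel" "f \<in> borel_measurable (lebesgue_on \<Omega>)"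
  shows "\<exists>g\<in>borel_measurable borel. AE x in lborel. x \<in> \<Omega> \<longrightarrow> f x = g x"
proof -
  have "(\<lambda>x. if x \<in> \<Omega> then f x else 0) \<in> borel_measurable lebesgue"
    using assms by (intro borel_measurable_if_I) auto
  from completion_ex_borel_measurable_real[OF this] obtain g
    where "g \<in> borel_measurable lborel" "AE x in lborel. (if x \<in> \<Omega> then f x else 0) = g x" by blast
  then show ?thesis by (intro bexI[of _ g]) (auto elim!: eventually_mono)
qed

lemma nn_integral_lebesgue_on:
  fixes f :: "'a::euclidean_space \<Rightarrow> ennreal"
  assumes "\<Omega> \<in> sets borel"
  shows "(\<integral>\<^sup>+x. f x \<partial>lebesgue_on \<Omega>) = (\<integral>\<^sup>+x. f x * indicator \<Omega> x \<partial>lborel)"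
  using assms by (subst nn_integral_restrict_space) (auto simp: nn_integral_completion)

theorem theorem5:
  assumes "CARD('n::finite) \<ge> 2"
  shows "\<exists>c1>0. \<exists>c2>0. \<forall>(\<Omega> :: (real ^ 'n) set) u.
    open \<Omega> \<longrightarrow> connected \<Omega> \<longrightarrow> frontier \<Omega> \<noteq> {} \<longrightarrow>
    u \<in> W1_0 (real CARD('n)) \<Omega> \<longrightarrow> M (real CARD('n)) \<Omega> u = 1 \<longrightarrow>
    (\<integral>\<^sup>+x. ennreal (Phi CARD('n) (u x / c1) / bdist \<Omega> x ^ CARD('n)) \<partial>lebesgue_on \<Omega>)
      \<le> ennreal c2"
proof -
  let ?N = "CARD('n)"
  define \<sigma> where "\<sigma> = annulus_vol TYPE(real ^ 'n)"
  have \<sigma>: "0 < \<sigma>" unfolding \<sigma>_def by (rule annulus_vol_pos)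
  define A where "A = 2 * 4 ^ (?N - 1) / \<sigma>"
  define B where "B = (3 * \<sigma> + 2 + 3 ^ ?N) / \<sigma>"
  define c1 where "c1 = max 1 B"
  define c2 where "c2 = exp 1 * (A + 1) * ((1 / 2) ^ ?N * (Tonelli_const TYPE(real ^ 'n) * (1 + 3 ^ ?N)))"
  have c1: "1 \<le> c1" "B \<le> c1" by (auto simp: c1_def)
  have "0 < A" using \<sigma> by (simp add: A_def)
  then have c2: "0 < c2" unfolding c2_def by (intro mult_pos_pos add_pos_pos) auto
  have "(\<integral>\<^sup>+x. ennreal (Phi ?N (u x / c1) / bdist \<Omega> x ^ ?N) \<partial>lebesgue_on \<Omega>) \<le> ennreal c2"
    if \<Omega>: "open \<Omega>" "frontier \<Omega> \<noteq> {}" and u: "u \<in> W1_0 (real ?N) \<Omega>" and M: "M (real ?N) \<Omega> u = 1"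
    for \<Omega> :: "(real ^ 'n) set" and u
  proof -
    have \<Omega>_borel: "\<Omega> \<in> sets borel" using \<Omega> by simp
    have powr_N: "x powr real ?N = x ^ ?N" if "0 \<le> x" for x :: real
      using that by (cases "x = 0") (simp_all add: powr_realpow zero_power)
    let ?g = "weak_gradient \<Omega> u"
    have "u \<in> borel_measurable (lebesgue_on \<Omega>)" "?g \<in> borel_measurable (lebesgue_on \<Omega>)"
      using u by (auto simp: W1_0_def W1_def Lp_on_def)
    then have meas: "u \<in> borel_measurable (lebesgue_on \<Omega>)"
      "(\<lambda>x. norm (?g x)) \<in> borel_measurable (lebesgue_on \<Omega>)"
      by (auto intro: borel_measurable_norm)
    obtain U where [measurable]: "U \<in> borel_measurable borel"
      and U: "AE x in lborel. x \<in> \<Omega> \<longrightarrow> u x = U x"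
      using borel_representative[OF \<Omega>_borel meas(1)] by (elim bexE)
    obtain G' where [measurable]: "G' \<in> borel_measurable borel"
      and G': "AE x in lborel. x \<in> \<Omega> \<longrightarrow> norm (?g x) = G' x"
      using borel_representative[OF \<Omega>_borel meas(2)] by (elim bexE)
    define G where "G x = \<bar>G' x\<bar>" for x
    have [measurable]: "G \<in> borel_measurable borel" unfolding G_def [abs_def] by measurable
    have G0: "0 \<le> G x" for x by (simp add: G_def)
    have G: "AE x in lborel. x \<in> \<Omega> \<longrightarrow> norm (?g x) = G x"
      using G'
    proof eventually_elim
      case (elim x)
      show ?case
      proof
        assume "x \<in> \<Omega>"
        then have "norm (?g x) = G' x" using elim by simp
        moreover have "0 \<le> norm (?g x)" by simp
        ultimately show "norm (?g x) = G x" unfolding G_def by linarith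
      qed
    qed
    obtain \<phi> where \<phi>: "\<And>n::nat. \<phi> n \<in> test_functions \<Omega>"
      and lim: "(\<lambda>n. \<integral>\<^sup>+x. ennreal (\<bar>u x - \<phi> n x\<bar> powr real ?N
             + norm (?g x - gradient (\<phi> n) x) powr real ?N) \<partial>lebesgue_on \<Omega>) \<longlonglongrightarrow> 0"
      using u by (auto simp: W1_0_def)
    have le: "(\<integral>\<^sup>+z. ennreal (\<bar>U z - \<phi> n z\<bar> ^ ?N + \<bar>norm (gradient (\<phi> n) z) - G z\<bar> ^ ?N) * indicator \<Omega> z \<partial>lborel)
      \<le> (\<integral>\<^sup>+x. ennreal (\<bar>u x - \<phi> n x\<bar> powr real ?N
             + norm (?g x - gradient (\<phi> n) x) powr real ?N) \<partial>lebesgue_on \<Omega>)" for n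
      unfolding nn_integral_lebesgue_on[OF \<Omega>_borel]
    proof (rule nn_integral_mono_AE)
      show "AE z in lborel. ennreal (\<bar>U z - \<phi> n z\<bar> ^ ?N + \<bar>norm (gradient (\<phi> n) z) - G z\<bar> ^ ?N) * indicator \<Omega> z
        \<le> ennreal (\<bar>u z - \<phi> n z\<bar> powr real ?N + norm (?g z - gradient (\<phi> n) z) powr real ?N) * indicator \<Omega> z"
        using U G
      proof eventually_elim
        case (elim z)
        show ?case
        proof (cases "z \<in> \<Omega>")
          case True
          have "\<bar>norm (gradient (\<phi> n) z) - G z\<bar> \<le> norm (?g z - gradient (\<phi> n) z)"
            using elim True norm_triangle_ineq3[of "gradient (\<phi> n) z" "?g z"]
            by (simp add: norm_minus_commute)
          then have "\<bar>norm (gradient (\<phi> n) z) - G z\<bar> ^ ?N \<le> norm (?g z - gradient (\<phi> n) z) ^ ?N"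
            by (intro power_mono) auto
          then show ?thesis using True elim by (simp add: powr_N ennreal_leI)
        qed simp
      qed
    qed
    have "(\<lambda>n. \<integral>\<^sup>+z. ennreal (\<bar>U z - \<phi> n z\<bar> ^ ?N + \<bar>norm (gradient (\<phi> n) z) - G z\<bar> ^ ?N) * indicator \<Omega> z \<partial>lborel)
      \<longlonglongrightarrow> 0"
      by (rule tendsto_sandwich[OF _ _ tendsto_const[of 0] lim])
        (simp, intro always_eventually allI le)
    note pot = AE_potential_bound[OF \<Omega> _ _ G0 \<phi> this]
    let ?I = "\<integral>\<^sup>+x. ennreal (norm (?g x) powr real ?N + \<bar>u x\<bar> powr real ?N / bdist \<Omega> x powr real ?N) \<partial>lebesgue_on \<Omega>"
    have I: "?I = 1"
    proof (cases ?I)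
      case (real i)
      then have "i powr (1 / real ?N) = 1" using M by (simp add: M_def epowr_def)
      moreover from this have "0 < i" using real by (cases "i = 0") auto
      ultimately have "i = 1" using powr_eq_one_iff_gen[of i "1 / real ?N"] by auto
      with real show ?thesis by simp
    next
      case top
      then show ?thesis using M by (simp add: M_def epowr_def)
    qed
    have bdist0: "0 \<le> bdist \<Omega> x" for x by (simp add: bdist_def infdist_nonneg)
    have "(\<integral>\<^sup>+z. ennreal (G z ^ ?N + \<bar>U z\<bar> ^ ?N / bdist \<Omega> z ^ ?N) * indicator \<Omega> z \<partial>lborel) = ?I"
      unfolding nn_integral_lebesgue_on[OF \<Omega>_borel]
    proof (rule nn_integral_cong_AE)
      show "AE z in lborel. ennreal (G z ^ ?N + \<bar>U z\<bar> ^ ?N / bdist \<Omega> z ^ ?N) * indicator \<Omega> z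
        = ennreal (norm (?g z) powr real ?N + \<bar>u z\<bar> powr real ?N / bdist \<Omega> z powr real ?N) * indicator \<Omega> z"
        using U G by eventually_elim (auto simp: powr_N bdist0 G0 indicator_def)
    qed
    then have int: "(\<integral>\<^sup>+z. ennreal (G z ^ ?N + \<bar>U z\<bar> ^ ?N / bdist \<Omega> z ^ ?N) * indicator \<Omega> z \<partial>lborel) \<le> 1"
      using I by simp
    have "(\<integral>\<^sup>+x. ennreal (Phi ?N (u x / c1) / bdist \<Omega> x ^ ?N) \<partial>lebesgue_on \<Omega>)
      = (\<integral>\<^sup>+x. ennreal (Phi ?N (U x / c1) / bdist \<Omega> x ^ ?N) * indicator \<Omega> x \<partial>lborel)"
      unfolding nn_integral_lebesgue_on[OF \<Omega>_borel]
      by (rule nn_integral_cong_AE) (use U in eventually_elim, auto simp: indicator_def)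
    also have "\<dots> \<le> ennreal c2"
      unfolding c2_def
      by (rule weighted_Phi_integral_le[OF assms \<Omega> _ _ G0 int pot A_def [unfolded \<sigma>_def] B_def [unfolded \<sigma>_def] c1])
        measurable
    finally show ?thesis .
  qed
  then show ?thesis using c1 c2 by (intro exI[of _ c1] conjI exI[of _ c2] allI impI) auto
qed

end
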